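(* Every germ at the origin of a hyperbolic $C^1$ vector field on the real line is contained in a $C^1$-continuous path of germs of hyperbolic $C^1$ vector fields, all having the same multiplier at the origin, and whose time-$1$ maps are pairwise non bi-Lipschitz conjugate (i.e. for any two distinct parameters of the path, the germs of the time-$1$ maps are not conjugate by a germ of bi-Lipschitz homeomorphism).
   Context: All germs are germs at $0$ of vector fields (resp. diffeomorphisms) on the real line having a singularity (resp. fixed point) at the origin. For a germ of $C^1$ vector field $X$ with $X(0)=0$, its multiplier is $\lambda := DX(0)$; $X$ is hyperbolic if $\lambda\neq 0$. The time-$1$ map is the germ at $0$ of the time-$1$ map of the flow of $X$. Germs of diffeomorphisms $f,g$ fixing $0$ are conjugate by a germ of homeomorphism $h$ fixing $0$ if $hfh^{-1}=g$ near $0$; they are bi-Lipschitz conjugate if $h$ can be chosen bi-Lipschitz on a neighborhood of $0$. A $C^1$-continuous path of germs is a family $(X_\alpha)_{\alpha\in I}$ indexed by a nondegenerate interval $I\subset\mathbb{R}$, having representatives defined on a common neighborhood $[-\delta,\delta]$ of $0$ that depend continuously on $\alpha$ in the $C^1$ topology on $[-\delta,\delta]$. *)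

theory Defs
  imports "HOL-Analysis.Analysis"
begin

text \<open>
  Germs at 0 are handled through representatives of type \<^typ>\<open>real \<Rightarrow> real\<close>; values of
  a representative away from 0 carry no meaning.
\<close>

definition germ_eq :: "(real \<Rightarrow> real) \<Rightarrow> (real \<Rightarrow> real) \<Rightarrow> bool" where
  "germ_eq X Y \<longleftrightarrow> (\<forall>\<^sub>F x in nhds 0. X x = Y x)"

text \<open>One-sided derivatives at the end points when \<open>S\<close> is a compact interval.\<close>

definition C1_on_with :: "real set \<Rightarrow> (real \<Rightarrow> real) \<Rightarrow> (real \<Rightarrow> real) \<Rightarrow> bool" where
  "C1_on_with S X X' \<longleftrightarrow>
     (\<forall>x\<in>S. (X has_real_derivative X' x) (at x within S)) \<and> continuous_on S X'"

definition C1_germ :: "(real \<Rightarrow> real) \<Rightarrow> bool" where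
  "C1_germ X \<longleftrightarrow> (\<exists>\<delta>>0. \<exists>X'. C1_on_with {-\<delta>..\<delta>} X X')"

definition multiplier :: "(real \<Rightarrow> real) \<Rightarrow> real" where
  "multiplier X = deriv X 0"

definition hyperbolic_C1_germ :: "(real \<Rightarrow> real) \<Rightarrow> bool" where
  "hyperbolic_C1_germ X \<longleftrightarrow> C1_germ X \<and> X 0 = 0 \<and> multiplier X \<noteq> 0"

definition C1_continuous_path :: "real set \<Rightarrow> (real \<Rightarrow> real \<Rightarrow> real) \<Rightarrow> bool" where
  "C1_continuous_path I Y \<longleftrightarrow>
     is_interval I \<and> (\<exists>a\<in>I. \<exists>b\<in>I. a \<noteq> b) \<and>
     (\<exists>\<delta>>0. \<exists>Z Z'. \<forall>\<alpha>\<in>I.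
        germ_eq (Z \<alpha>) (Y \<alpha>) \<and>
        C1_on_with {-\<delta>..\<delta>} (Z \<alpha>) (Z' \<alpha>) \<and>
        uniform_limit {-\<delta>..\<delta>} Z (Z \<alpha>) (at \<alpha> within I) \<and>
        uniform_limit {-\<delta>..\<delta>} Z' (Z' \<alpha>) (at \<alpha> within I))"

text \<open>
  The trajectories have to stay where \<open>X\<close> is \<open>C\<^sup>1\<close>. This makes them unique, so that all
  \<open>f\<close> satisfying the following predicate have the same germ at 0 (for \<open>X 0 = 0\<close>), and that germ
  depends neither on \<open>r\<close> nor on the representative \<open>X\<close>.
\<close>

definition is_time_one_map :: "(real \<Rightarrow> real) \<Rightarrow> (real \<Rightarrow> real) \<Rightarrow> bool" where
  "is_time_one_map X f \<longleftrightarrow>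
     (\<exists>r>0. \<exists>X'. C1_on_with {-r..r} X X' \<and>
        (\<forall>\<^sub>F x in nhds 0. \<exists>\<phi>. \<phi> 0 = x \<and> \<phi> 1 = f x \<and>
           (\<forall>t\<in>{0..1}. \<phi> t \<in> {-r..r} \<and>
              (\<phi> has_real_derivative X (\<phi> t)) (at t within {0..1}))))"

text \<open>
  A representative of the germ of the time-1 map. It exists for every \<open>C\<^sup>1\<close> germ \<open>X\<close> with
  \<open>X 0 = 0\<close>, and only its germ at 0 matters.
\<close>

definition time_one_map :: "(real \<Rightarrow> real) \<Rightarrow> real \<Rightarrow> real" where
  "time_one_map X = (SOME f. is_time_one_map X f)"

text \<open>
  Here \<open>k\<close> is the local inverse of \<open>h\<close>. The conjugacy \<open>h\<close> may reverse orientation.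
\<close>

definition bilipschitz_conjugate :: "(real \<Rightarrow> real) \<Rightarrow> (real \<Rightarrow> real) \<Rightarrow> bool" where
  "bilipschitz_conjugate f g \<longleftrightarrow>
     (\<exists>U V h k. open U \<and> open V \<and> 0 \<in> U \<and> homeomorphism U V h k \<and> h 0 = 0 \<and>
        (\<exists>L. L-lipschitz_on U h \<and> L-lipschitz_on V k) \<and>
        (\<forall>\<^sub>F y in nhds 0. h (f (k y)) = g y))"

end

theory Submission
  imports Defs
begin

text \<open>
  The path is \<open>Y\<^sub>\<alpha>(x) = X(x) - \<alpha> x / ln \<bar>x\<bar>\<close> for \<open>\<alpha> \<in> [0, 1]\<close>. Let \<open>T\<^sub>\<alpha>\<close> be an antiderivative of
  \<open>1 / Y\<^sub>\<alpha>\<close> off 0, so that the time-1 map \<open>f\<^sub>\<alpha>\<close> satisfies \<open>T\<^sub>\<alpha> \<circ> f\<^sub>\<alpha> = T\<^sub>\<alpha> + 1\<close>. If \<open>h\<close> conjugates \<open>f\<^sub>\<alpha>\<close>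
  to \<open>f\<^sub>\<beta>\<close>, then \<open>T\<^sub>\<beta> \<circ> h - T\<^sub>\<alpha>\<close> is \<open>f\<^sub>\<alpha>\<close>-invariant, hence bounded by its values on a compact fundamental
  domain. Since \<open>1 / Y\<^sub>\<beta>\<close> is of size \<open>1 / \<bar>x\<bar>\<close>, the function \<open>T\<^sub>\<beta>\<close> varies by a bounded amount between points
  of comparable modulus on the same side of 0, so a bi-Lipschitz \<open>h\<close> forces \<open>T\<^sub>\<beta> - T\<^sub>\<alpha>\<close>, summed over
  \<open>x\<close> and \<open>-x\<close>, to be bounded near 0. But the modulus of that sum grows
  at least like a positive multiple of \<open>\<bar>\<beta> - \<alpha>\<bar> ln (- ln \<bar>x\<bar>)\<close>.
\<close>

subsection \<open>Hyperbolic fields on a half-line\<close>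

text \<open>
  \<open>\<sigma>\<close> is the sign of the multiplier; both signs are treated at once. The function \<open>t\<close> is the
  time coordinate of the flow of \<open>z\<close>.
\<close>

locale half_line_field =
  fixes \<sigma> m M \<delta> :: real and z t :: "real \<Rightarrow> real"
  assumes sigma: "\<bar>\<sigma>\<bar> = 1" and m_pos: "0 < m" and m_le_M: "m \<le> M"
    and lower: "\<lbrakk>0 < x; x < \<delta>\<rbrakk> \<Longrightarrow> m * x \<le> \<sigma> * z x"
    and upper: "\<lbrakk>0 < x; x < \<delta>\<rbrakk> \<Longrightarrow> \<sigma> * z x \<le> M * x"
    and deriv_t: "\<lbrakk>0 < x; x < \<delta>\<rbrakk> \<Longrightarrow> (t has_real_derivative 1 / z x) (at x)"
begin

section \<open>Logarithmic control of the time coordinate\<close>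

lemma M_pos: "0 < M"
  using m_pos m_le_M by linarith

lemma z_nonzero: "\<lbrakk>0 < x; x < \<delta>\<rbrakk> \<Longrightarrow> z x \<noteq> 0"
  using lower[of x] m_pos by (metis mult_pos_pos mult_zero_right not_le)

lemma sigma_cases: "\<sigma> = 1 \<or> \<sigma> = -1"
  using sigma by linarith

lemma sigma_over_z:
  assumes "0 < x" "x < \<delta>"
  shows "1 / (M * x) \<le> \<sigma> / z x" "\<sigma> / z x \<le> 1 / (m * x)"
proof -
  have eq: "\<sigma> / z x = 1 / (\<sigma> * z x)"
    using sigma_cases by auto
  have pos: "0 < m * x" using assms m_pos by simp
  show "1 / (M * x) \<le> \<sigma> / z x" "\<sigma> / z x \<le> 1 / (m * x)"
    unfolding eq using lower[OF assms] upper[OF assms] pos by (auto intro: frac_le)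
qed

lemma continuous_t:
  assumes "A \<subseteq> {0<..<\<delta>}"
  shows "continuous_on A t"
proof (rule DERIV_continuous_on)
  fix x assume "x \<in> A"
  with assms have "x \<in> {0<..<\<delta>}" by (rule subsetD)
  then have "(t has_real_derivative 1 / z x) (at x)" by (intro deriv_t) simp_all
  then show "(t has_real_derivative 1 / z x) (at x within A)"
    by (rule has_field_derivative_at_within)
qed

text \<open>Integrated form of \<open>sigma_over_z\<close>: the slope of \<open>\<sigma> * t\<close>
  lies between those of \<open>ln / M\<close> and \<open>ln / m\<close>. The later size estimates
  for \<open>t\<close> come from here.\<close>

lemma t_increment:
  assumes "0 < x" "x \<le> y" "y < \<delta>"
  shows "(ln y - ln x) / M \<le> \<sigma> * (t y - t x)" "\<sigma> * (t y - t x) \<le> (ln y - ln x) / m"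
proof -
  have "\<sigma> * t x - ln x / M \<le> \<sigma> * t y - ln y / M"
  proof (rule DERIV_nonneg_imp_nondecreasing[OF assms(2)])
    fix w assume w: "x \<le> w" "w \<le> y"
    then have w': "0 < w" "w < \<delta>" using assms by auto
    have "((\<lambda>w. \<sigma> * t w - ln w / M) has_real_derivative \<sigma> * (1 / z w) - 1 / w / M) (at w)"
      using w' M_pos by (auto intro!: derivative_eq_intros deriv_t)
    moreover have "\<sigma> * (1 / z w) - 1 / w / M \<ge> 0"
      using sigma_over_z(1)[OF w'] by (simp add: mult.commute)
    ultimately show "\<exists>d. ((\<lambda>w. \<sigma> * t w - ln w / M) has_real_derivative d) (at w) \<and> 0 \<le> d"
      by blast
  qed
  then show "(ln y - ln x) / M \<le> \<sigma> * (t y - t x)"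
    by (simp add: algebra_simps diff_divide_distrib)
  have "ln x / m - \<sigma> * t x \<le> ln y / m - \<sigma> * t y"
  proof (rule DERIV_nonneg_imp_nondecreasing[OF assms(2)])
    fix w assume w: "x \<le> w" "w \<le> y"
    then have w': "0 < w" "w < \<delta>" using assms by auto
    have "((\<lambda>w. ln w / m - \<sigma> * t w) has_real_derivative 1 / w / m - \<sigma> * (1 / z w)) (at w)"
      using w' m_pos by (auto intro!: derivative_eq_intros deriv_t)
    moreover have "1 / w / m - \<sigma> * (1 / z w) \<ge> 0"
      using sigma_over_z(2)[OF w'] by (simp add: mult.commute)
    ultimately show "\<exists>d. ((\<lambda>w. ln w / m - \<sigma> * t w) has_real_derivative d) (at w) \<and> 0 \<le> d"
      by blast
  qed
  then show "\<sigma> * (t y - t x) \<le> (ln y - ln x) / m"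
    by (simp add: algebra_simps diff_divide_distrib)
qed

lemma t_less_iff:
  assumes "0 < x" "x < \<delta>" "0 < y" "y < \<delta>"
  shows "\<sigma> * t x < \<sigma> * t y \<longleftrightarrow> x < y"
proof -
  have *: "\<sigma> * t x < \<sigma> * t y" if "0 < x" "x < y" "y < \<delta>" for x y
  proof -
    have "0 < (ln y - ln x) / M" using that M_pos by simp
    then show ?thesis
      using t_increment(1)[of x y] that by (simp add: algebra_simps)
  qed
  show ?thesis
    using *[of x y] *[of y x] assms by (cases x y rule: linorder_cases) auto
qed

lemma inj_t: "inj_on t {0<..<\<delta>}"
proof (rule inj_onI)
  fix x y assume "x \<in> {0<..<\<delta>}" "y \<in> {0<..<\<delta>}" "t x = t y"
  then show "x = y"
    using t_less_iff[of x y] t_less_iff[of y x] by (cases x y rule: linorder_cases) auto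
qed

lemma t_abs_diff:
  assumes "0 < x" "x < \<delta>" "0 < y" "y < \<delta>" "\<bar>ln y - ln x\<bar> \<le> B"
  shows "\<bar>t y - t x\<bar> \<le> B / m"
proof -
  have *: "\<bar>t y - t x\<bar> \<le> B / m" if "0 < x" "x \<le> y" "y < \<delta>" "\<bar>ln y - ln x\<bar> \<le> B" for x y
  proof -
    have "\<bar>t y - t x\<bar> = \<bar>\<sigma> * (t y - t x)\<bar>" using sigma by (simp add: abs_mult)
    also have "\<dots> = \<sigma> * (t y - t x)"
    proof -
      have "0 \<le> (ln y - ln x) / M" using that M_pos by simp
      then show ?thesis using t_increment(1)[of x y] that by linarith
    qed
    also have "\<dots> \<le> (ln y - ln x) / m" using t_increment(2) that by simp
    also have "\<dots> \<le> B / m" using that m_pos by (intro divide_right_mono) auto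
    finally show ?thesis .
  qed
  show ?thesis
    using *[of x y] *[of y x] assms by (cases x y rule: linorder_cases) (auto simp: abs_minus_commute)
qed

text \<open>A unit step of \<open>\<sigma> * t\<close> leads away from 0, along the flow if
  \<open>\<sigma> = 1\<close> and against it if \<open>\<sigma> = -1\<close>. Exponentiating
  \<open>t_increment\<close> bounds the expansion factor uniformly.\<close>

lemma t_ratio:
  assumes "0 < x" "x < \<delta>" "0 < y" "y < \<delta>" "\<sigma> * t y = \<sigma> * t x + 1"
  shows "x * exp m \<le> y" "y \<le> x * exp M"
proof -
  have "x < y" using t_less_iff[of x y] assms by simp
  then have "(ln y - ln x) / M \<le> 1" "1 \<le> (ln y - ln x) / m"
    using t_increment[of x y] assms by (auto simp: algebra_simps)
  then have "ln y \<le> ln x + M" "ln x + m \<le> ln y"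
    using m_pos M_pos by (auto simp: field_simps)
  then have "exp (ln y) \<le> exp (ln x + M)" "exp (ln x + m) \<le> exp (ln y)"
    by auto
  then show "x * exp m \<le> y" "y \<le> x * exp M"
    using assms by (simp_all add: exp_add)
qed

section \<open>The flow as a translation in time\<close>

text \<open>By \<open>t_increment\<close>, passing from \<open>y\<close> to \<open>y * exp M\<close>
  or to \<open>y * exp (-M)\<close> changes \<open>\<sigma> * t\<close> by at least 1, so the
  intermediate value theorem applies on this window. Smallness of \<open>y\<close> keeps the window
  inside \<open>{0<..<\<delta>}\<close>.\<close>

lemma t_attains:
  assumes "0 < y" "y * exp M < \<delta>" "\<bar>\<tau>\<bar> \<le> 1"
  obtains x where "0 < x" "x \<le> y * exp M" "x < \<delta>" "t x = t y + \<tau>"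
proof -
  let ?a = "y * exp (-M)" and ?b = "y * exp M"
  have ab: "0 < ?a" "?a \<le> y" "y \<le> ?b" "?b < \<delta>"
    using assms M_pos by auto
  have "1 \<le> \<sigma> * (t y - t ?a)"
    using t_increment(1)[of ?a y] ab assms M_pos by (simp add: ln_mult)
  moreover have "1 \<le> \<sigma> * (t ?b - t y)"
    using t_increment(1)[of y ?b] ab assms M_pos by (simp add: ln_mult)
  moreover have "\<bar>\<sigma> * \<tau>\<bar> \<le> 1" using assms sigma by (simp add: abs_mult)
  ultimately have "\<sigma> * t ?a \<le> \<sigma> * (t y + \<tau>)" "\<sigma> * (t y + \<tau>) \<le> \<sigma> * t ?b"
    by (auto simp: algebra_simps abs_le_iff)
  moreover have "continuous_on {?a..?b} (\<lambda>x. \<sigma> * t x)"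
    using ab by (intro continuous_intros continuous_t) auto
  ultimately obtain x where "?a \<le> x" "x \<le> ?b" "\<sigma> * t x = \<sigma> * (t y + \<tau>)"
    using IVT'[of "\<lambda>x. \<sigma> * t x" ?a "\<sigma> * (t y + \<tau>)" ?b] ab by auto
  moreover have "\<sigma> \<noteq> 0" using sigma by auto
  ultimately show thesis using ab by (intro that[of x]) auto
qed

text \<open>In the coordinate \<open>t\<close> the flow is a translation, so the trajectory is
  explicit: \<open>g (t y + \<tau>)\<close> with \<open>g\<close> the inverse of \<open>t\<close>,
  whose derivative at \<open>t x\<close> is \<open>z x\<close>.\<close>

lemma trajectory_exists:
  assumes "0 < y" "y * exp M < \<delta>"
  obtains \<phi> where "\<phi> 0 = y"
    "\<And>\<tau>. \<tau> \<in> {0..1} \<Longrightarrow> 0 < \<phi> \<tau> \<and> \<phi> \<tau> < \<delta> \<and>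
       (\<phi> has_real_derivative z (\<phi> \<tau>)) (at \<tau> within {0..1})"
proof -
  define g where "g = inv_into {0<..<\<delta>} t"
  have g: "g (t x) = x" if "x \<in> {0<..<\<delta>}" for x
    unfolding g_def using inj_t that by (rule inv_into_f_f)
  have dg: "(g has_real_derivative z x) (at (t x))" if "x \<in> {0<..<\<delta>}" for x
    unfolding has_field_derivative_def
  proof (rule has_derivative_inverse_on[where f = t and S = "{0<..<\<delta>}" and f' = "\<lambda>x. (*) (1 / z x)"
        and g' = "\<lambda>x. (*) (z x)"])
    fix x assume "x \<in> {0<..<\<delta>}"
    then show "(t has_derivative (*) (1 / z x)) (at x)"
      using deriv_t[of x] by (simp add: has_field_derivative_def)
  next
    show "(*) (1 / z x) \<circ> (*) (z x) = id"
      using z_nonzero[of x] that by auto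
  qed (use g that in auto)
  define \<phi> where "\<phi> \<tau> = g (t y + \<tau>)" for \<tau>
  have y: "y < \<delta>"
    using assms M_pos by (smt (verit) mult_le_cancel_left1 one_le_exp_iff)
  show thesis
  proof (rule that[of \<phi>])
    show "\<phi> 0 = y" using g[of y] assms y by (simp add: \<phi>_def)
    fix \<tau> :: real assume "\<tau> \<in> {0..1}"
    then obtain x where x: "0 < x" "x < \<delta>" "t x = t y + \<tau>"
      using t_attains[OF assms, of \<tau>] by auto
    then have "\<phi> \<tau> = x" using g[of x] by (simp add: \<phi>_def)
    moreover have "((\<lambda>\<tau>. g (t y + \<tau>)) has_real_derivative z x * 1) (at \<tau>)"
      by (rule DERIV_chain2[of g]) (use dg[of x] x in \<open>auto intro!: derivative_eq_intros\<close>)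
    then have "(\<phi> has_real_derivative z x) (at \<tau>)"
      unfolding \<phi>_def by simp
    ultimately show "0 < \<phi> \<tau> \<and> \<phi> \<tau> < \<delta> \<and>
        (\<phi> has_real_derivative z (\<phi> \<tau>)) (at \<tau> within {0..1})"
      using x by (auto intro: has_field_derivative_at_within)
  qed
qed

text \<open>Formulated for an arbitrary trajectory in the half-line, since
  \<open>is_time_one_map\<close> does not refer to the one built above.\<close>

lemma t_along_trajectory:
  assumes "\<And>\<tau>. \<tau> \<in> {0..1} \<Longrightarrow> 0 < \<phi> \<tau> \<and> \<phi> \<tau> < \<delta> \<and>
       (\<phi> has_real_derivative z (\<phi> \<tau>)) (at \<tau> within {0..1})"
  shows "t (\<phi> 1) = t (\<phi> 0) + 1"
proof -
  have "\<exists>c. \<forall>\<tau>\<in>{0..1}. t (\<phi> \<tau>) - \<tau> = c"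
  proof (rule has_field_derivative_zero_constant)
    fix \<tau> :: real assume \<tau>: "\<tau> \<in> {0..1}"
    have "((\<lambda>\<tau>. t (\<phi> \<tau>)) has_real_derivative (1 / z (\<phi> \<tau>)) * z (\<phi> \<tau>)) (at \<tau> within {0..1})"
      by (rule DERIV_chain2[of t]) (use assms[OF \<tau>] deriv_t in auto)
    from DERIV_diff[OF this DERIV_ident]
    show "((\<lambda>\<tau>. t (\<phi> \<tau>) - \<tau>) has_real_derivative 0) (at \<tau> within {0..1})"
      using z_nonzero[of "\<phi> \<tau>"] assms[OF \<tau>] by simp
  qed auto
  then obtain c where c: "\<And>\<tau>. \<tau> \<in> {0..1} \<Longrightarrow> t (\<phi> \<tau>) - \<tau> = c" by blast
  show ?thesis using c[of 0] c[of 1] by simp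
qed

text \<open>Every point near 0 can be moved outward along its orbit, without changing
  \<open>u\<close>, into the compact interval \<open>{q * exp (-M)..q}\<close> with
  \<open>q = a / 2\<close>; there \<open>u\<close> is bounded by continuity.\<close>

lemma invariant_function_bounded:
  fixes f u :: "real \<Rightarrow> real"
  assumes a: "0 < a" "a \<le> \<delta>"
    and f: "\<And>p. \<lbrakk>0 < p; p < a\<rbrakk> \<Longrightarrow> 0 < f p \<and> f p < \<delta> \<and> t (f p) = t p + 1"
    and inv: "\<And>p. \<lbrakk>0 < p; p < a\<rbrakk> \<Longrightarrow> u (f p) = u p"
    and cont: "continuous_on {0<..<a} u"
  obtains C where "\<And>p. \<lbrakk>0 < p; p \<le> a / 2\<rbrakk> \<Longrightarrow> \<bar>u p\<bar> \<le> C"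
proof -
  \<comment> \<open>Half of \<open>a\<close>, so that the compact interval lies inside the open one
    where \<open>u\<close> is continuous and invariant.\<close>
  define q where "q = a / 2"
  have q: "0 < q" "q < a" using a by (auto simp: q_def)
  have qM: "q * exp (-M) \<le> q" "0 < q * exp (-M)" using q M_pos by auto
  \<comment> \<open>An outward step expands by at least \<open>exp m\<close>, which gives definite
    progress, and by at most \<open>exp M\<close>, so it cannot jump over
    \<open>{q * exp (-M)..q}\<close>.\<close>
  have step: "\<exists>p'. p * exp m \<le> p' \<and> p' \<le> q \<and> u p' = u p" if p: "0 < p" "p < q * exp (-M)" for p
  proof -
    have pM: "p * exp M < q"
      using p by (simp add: exp_minus field_simps)
    have pd: "p < \<delta>" using p q a qM by linarith
    have pa: "p < a" using p q a qM by linarith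
    consider "\<sigma> = 1" | "\<sigma> = -1" using sigma_cases by blast
    then show ?thesis
    proof cases
      case 1
      then show ?thesis
        using t_ratio[of p "f p"] f[of p] inv[of p] p pd pM pa by (intro exI[of _ "f p"]) auto
    next
      case 2
      \<comment> \<open>Here \<open>f\<close> contracts, so the outward step goes back in time:
        \<open>p'\<close> is a preimage of \<open>p\<close>, recognised through injectivity of
        \<open>t\<close>.\<close>
      obtain p' where p': "0 < p'" "p' \<le> p * exp M" "p' < \<delta>" "t p' = t p + (-1)"
        using t_attains[of p "-1"] p pM q a by auto
      then have "p' < a" using pM q by linarith
      then have "f p' = p"
        using f[of p'] p' p pd inj_onD[OF inj_t, of "f p'" p] by simp
      then have "u p' = u p" using inv[of p'] p' \<open>p' < a\<close> by simp
      moreover have "p * exp m \<le> p'" using t_ratio(1)[of p p'] p pd p' 2 by simp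
      ultimately show ?thesis using p' pM by (intro exI[of _ p']) auto
    qed
  qed
  \<comment> \<open>\<open>n\<close> bounds the number of outward steps, each of which gains a
    factor \<open>exp m\<close>.\<close>
  have reach: "\<exists>p'\<in>{q * exp (-M)..q}. u p' = u p"
    if "0 < p" "p \<le> q" "q * exp (- real n * m) \<le> p" for n p
    using that
  proof (induction n arbitrary: p)
    case 0
    then show ?case using qM by (intro bexI[of _ p]) auto
  next
    case (Suc n)
    show ?case
    proof (cases "p < q * exp (-M)")
      case True
      then obtain p' where p': "p * exp m \<le> p'" "p' \<le> q" "u p' = u p"
        using step Suc.prems by blast
      have "0 < p * exp m" using Suc.prems by simp
      have "q * exp (- real n * m) = q * exp (- real (Suc n) * m) * exp m"
        by (simp add: exp_add[symmetric] algebra_simps)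
      also have "\<dots> \<le> p * exp m" using Suc.prems by (intro mult_right_mono) auto
      finally show ?thesis
        using Suc.IH[of p'] p' \<open>0 < p * exp m\<close> by auto
    qed (use Suc.prems in \<open>intro bexI[of _ p], auto\<close>)
  qed
  have "compact (u ` {q * exp (-M)..q})"
    using less_le_trans[OF qM(2)] q
    by (intro compact_continuous_image continuous_on_subset[OF cont]) (auto intro: le_less_trans)
  then have "bounded (u ` {q * exp (-M)..q})"
    by (rule compact_imp_bounded)
  then obtain C where "\<forall>y\<in>u ` {q * exp (-M)..q}. \<bar>y\<bar> \<le> C"
    unfolding bounded_iff real_norm_def by blast
  then have C: "\<bar>u p\<bar> \<le> C" if "p \<in> {q * exp (-M)..q}" for p
    using that by blast
  show thesis
  proof (rule that)
    fix p :: real assume p: "0 < p" "p \<le> a / 2"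
    obtain n :: nat where "(ln q - ln p) / m < real n" using reals_Archimedean2 by blast
    then have "ln q - real n * m < ln p" using m_pos by (simp add: field_simps)
    then have "exp (ln q - real n * m) \<le> exp (ln p)" by simp
    then have "q * exp (- real n * m) \<le> p"
      using q p by (simp add: exp_diff exp_minus field_simps)
    then show "\<bar>u p\<bar> \<le> C" using reach[of p n] C p q_def by force
  qed
qed

end

subsection \<open>Both half-lines and the time-1 map\<close>

text \<open>\<open>\<lambda>x. s * Z (s * x)\<close> is \<open>Z\<close> transported by the
  reflection of sign \<open>s\<close>, so both half-lines become instances of one locale. The common
  \<open>\<sigma>\<close> says that both are attracted to 0 or both repelled; the two branches of
  \<open>T\<close> have independent constants of integration.\<close>

definition line_field ::
  "real \<Rightarrow> real \<Rightarrow> real \<Rightarrow> real \<Rightarrow> (real \<Rightarrow> real) \<Rightarrow> (real \<Rightarrow> real) \<Rightarrow> bool" where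
  "line_field \<sigma> m M \<delta> Z T \<longleftrightarrow>
     (\<forall>s\<in>{-1, 1}. half_line_field \<sigma> m M \<delta> (\<lambda>x. s * Z (s * x)) (\<lambda>x. T (s * x)))"

lemma line_field_deriv:
  assumes "line_field \<sigma> m M \<delta> Z T" "x \<noteq> 0" "\<bar>x\<bar> < \<delta>"
  shows "(T has_real_derivative 1 / Z x) (at x)"
proof -
  define s where "s = sgn x"
  have s: "s \<in> {-1, 1}" "x = s * \<bar>x\<bar>" "s * s = 1" "s * x = \<bar>x\<bar>"
    using assms(2) by (auto simp: s_def sgn_if)
  interpret half_line_field \<sigma> m M \<delta> "\<lambda>x. s * Z (s * x)" "\<lambda>x. T (s * x)"
    using assms s unfolding line_field_def by blast
  have "((\<lambda>x. T (s * x)) has_real_derivative 1 / (s * Z x)) (at (s * x))"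
    using deriv_t[of "\<bar>x\<bar>"] assms s by auto
  then have "((\<lambda>y. T (s * (s * y))) has_real_derivative 1 / (s * Z x) * s) (at x)"
    by (rule DERIV_chain2[of "\<lambda>x. T (s * x)"]) (auto intro!: derivative_eq_intros)
  then show ?thesis
    using s by (auto simp: mult.assoc[symmetric])
qed

text \<open>The antiderivatives are chosen on each half-line separately and then glued. Comparing
  \<open>x * Z x\<close> with \<open>x\<^sup>2\<close> expresses the signed linear bounds on both
  sides at once.\<close>

lemma line_field_exists:
  assumes \<sigma>: "\<bar>\<sigma>\<bar> = 1" "0 < m" "m \<le> M" "0 < \<delta>"
    and cont: "\<And>x. \<bar>x\<bar> < \<delta> \<Longrightarrow> isCont Z x"
    and bounds: "\<And>x. \<bar>x\<bar> < \<delta> \<Longrightarrow> m * x\<^sup>2 \<le> \<sigma> * (x * Z x) \<and> \<sigma> * (x * Z x) \<le> M * x\<^sup>2"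
  obtains T where "line_field \<sigma> m M \<delta> Z T"
proof -
  have ants: "\<exists>F. \<forall>x. 0 < x \<and> x < \<delta> \<longrightarrow> (F has_real_derivative 1 / (s * Z (s * x))) (at x)"
    if s: "s \<in> {-1, 1}" for s
  proof -
    have "isCont (\<lambda>x. 1 / (s * Z (s * x))) x" if "0 < ereal x" "ereal x < ereal \<delta>" for x
    proof -
      have x: "0 < x" "x < \<delta>" "\<bar>s * x\<bar> < \<delta>" using that s by auto
      have "0 < m * (s * x)\<^sup>2" using \<sigma> x s by auto
      then have "Z (s * x) \<noteq> 0" using bounds[OF x(3)] by auto
      then show ?thesis
        using s cont[OF x(3)] by (auto intro!: continuous_intros isCont_o2[where g = Z])
    qed
    then obtain F where "\<forall>x. 0 < ereal x \<longrightarrow> ereal x < ereal \<delta> \<longrightarrow>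
        (F has_vector_derivative 1 / (s * Z (s * x))) (at x)"
      using einterval_antiderivative[of 0 "ereal \<delta>" "\<lambda>x. 1 / (s * Z (s * x))"] \<sigma> by auto
    then show ?thesis
      by (auto simp: has_real_derivative_iff_has_vector_derivative)
  qed
  obtain F G where
    F: "\<And>x. \<lbrakk>0 < x; x < \<delta>\<rbrakk> \<Longrightarrow> (F has_real_derivative 1 / Z x) (at x)" and
    G: "\<And>x. \<lbrakk>0 < x; x < \<delta>\<rbrakk> \<Longrightarrow> (G has_real_derivative 1 / (- Z (- x))) (at x)"
    using ants[of 1] ants[of "-1"] by auto
  define T where "T x = (if 0 < x then F x else G (- x))" for x
  have "half_line_field \<sigma> m M \<delta> (\<lambda>x. s * Z (s * x)) (\<lambda>x. T (s * x))" if s: "s \<in> {-1, 1}" for s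
  proof
    fix x :: real assume x: "0 < x" "x < \<delta>"
    have "\<bar>s * x\<bar> < \<delta>" "(s * x)\<^sup>2 = x * x" using x s by (auto simp: power2_eq_square)
    then have "x * (m * x) \<le> x * (\<sigma> * (s * Z (s * x)))" "x * (\<sigma> * (s * Z (s * x))) \<le> x * (M * x)"
      using bounds[of "s * x"] by (auto simp: mult_ac)
    then show "m * x \<le> \<sigma> * (s * Z (s * x))" "\<sigma> * (s * Z (s * x)) \<le> M * x"
      using x by auto
    have near: "\<forall>\<^sub>F y in nhds x. 0 < y"
      using x by (intro order_tendstoD(1)[OF filterlim_ident])
    show "((\<lambda>x. T (s * x)) has_real_derivative 1 / (s * Z (s * x))) (at x)"
    proof (cases "s = 1")
      case True
      have "\<forall>\<^sub>F y in nhds x. T (s * y) = F y"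
        using near by eventually_elim (simp add: True T_def)
      from DERIV_cong_ev[OF refl this refl] show ?thesis using F[OF x] True by simp
    next
      case False
      then have "s = -1" using s by auto
      have "\<forall>\<^sub>F y in nhds x. T (s * y) = G y"
        using near by eventually_elim (simp add: \<open>s = -1\<close> T_def)
      from DERIV_cong_ev[OF refl this refl] show ?thesis using G[OF x] \<open>s = -1\<close> by simp
    qed
  qed (use \<sigma> in auto)
  then show thesis using that unfolding line_field_def by blast
qed

text \<open>Points on one side with moduli in ratio at most \<open>L\<close> have logarithms at
  distance at most \<open>ln L\<close>. The bound does not depend on how close they are to
  0.\<close>

lemma line_field_compare:
  assumes "line_field \<sigma> m M \<delta> Z T" "0 < x * y" "\<bar>x\<bar> < \<delta>" "\<bar>y\<bar> < \<delta>"
    "\<bar>x\<bar> \<le> L * \<bar>y\<bar>" "\<bar>y\<bar> \<le> L * \<bar>x\<bar>" "0 < L"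
  shows "\<bar>T x - T y\<bar> \<le> ln L / m"
proof -
  define s where "s = sgn x"
  have s: "s \<in> {-1, 1}" "x = s * \<bar>x\<bar>" "y = s * \<bar>y\<bar>"
    using assms(2) by (auto simp: s_def sgn_if zero_less_mult_iff)
  have nz: "0 < \<bar>x\<bar>" "0 < \<bar>y\<bar>" using assms(2) by auto
  interpret half_line_field \<sigma> m M \<delta> "\<lambda>x. s * Z (s * x)" "\<lambda>x. T (s * x)"
    using assms s unfolding line_field_def by blast
  have "ln \<bar>x\<bar> \<le> ln (L * \<bar>y\<bar>)" "ln \<bar>y\<bar> \<le> ln (L * \<bar>x\<bar>)"
    using assms nz by (auto intro!: ln_mono)
  then have "\<bar>ln \<bar>x\<bar> - ln \<bar>y\<bar>\<bar> \<le> ln L"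
    using nz assms by (simp add: ln_mult abs_le_iff)
  from t_abs_diff[OF nz(2) assms(4) nz(1) assms(3) this] show ?thesis
    using s by simp
qed

text \<open>\<open>time_one_map\<close> is a \<open>SOME\<close> term, so its defining property
  requires a witness. This comes from \<open>trajectory_exists\<close> by reflection, with
  \<open>r = \<delta>\<close>.\<close>

lemma time_one_map_exists:
  assumes lf: "line_field \<sigma> m M \<delta> Z T" and "C1_on_with {-\<delta>..\<delta>} Z Z'" "Z 0 = 0" "0 < \<delta>"
  shows "is_time_one_map Z (time_one_map Z)"
proof -
  define traj where "traj x \<phi> \<longleftrightarrow> \<phi> 0 = x \<and> (\<forall>t\<in>{0..1}. \<phi> t \<in> {-\<delta>..\<delta>} \<and>
     (\<phi> has_real_derivative Z (\<phi> t)) (at t within {0..1}))" for x \<phi>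
  have ex: "\<exists>\<phi>. traj x \<phi>" if x: "\<bar>x\<bar> * exp M < \<delta>" for x
  proof (cases "x = 0")
    case True
    then show ?thesis
      using assms by (intro exI[of _ "\<lambda>_. 0"]) (auto simp: traj_def)
  next
    case False
    define s where "s = sgn x"
    have s: "s \<in> {-1, 1}" "x = s * \<bar>x\<bar>" "s * s = 1"
      using False by (auto simp: s_def sgn_if)
    interpret half_line_field \<sigma> m M \<delta> "\<lambda>x. s * Z (s * x)" "\<lambda>x. T (s * x)"
      using lf s unfolding line_field_def by blast
    obtain \<phi> where \<phi>: "\<phi> 0 = \<bar>x\<bar>" "\<And>\<tau>. \<tau> \<in> {0..1} \<Longrightarrow> 0 < \<phi> \<tau> \<and> \<phi> \<tau> < \<delta> \<and>
       (\<phi> has_real_derivative s * Z (s * \<phi> \<tau>)) (at \<tau> within {0..1})"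
      using trajectory_exists[of "\<bar>x\<bar>"] x False by auto
    have "traj x (\<lambda>\<tau>. s * \<phi> \<tau>)"
      unfolding traj_def
    proof (intro conjI ballI)
      fix \<tau> :: real assume \<tau>: "\<tau> \<in> {0..1}"
      have "((\<lambda>\<tau>. s * \<phi> \<tau>) has_real_derivative s * (s * Z (s * \<phi> \<tau>))) (at \<tau> within {0..1})"
        using \<phi>(2)[OF \<tau>] by (intro DERIV_cmult) auto
      then show "((\<lambda>\<tau>. s * \<phi> \<tau>) has_real_derivative Z (s * \<phi> \<tau>)) (at \<tau> within {0..1})"
        using s by (simp add: mult.assoc[symmetric])
      show "s * \<phi> \<tau> \<in> {-\<delta>..\<delta>}" using \<phi>(2)[OF \<tau>] s by auto
    qed (use \<phi> s in auto)
    then show ?thesis by blast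
  qed
  define f where "f x = (SOME \<phi>. traj x \<phi>) 1" for x
  have "((\<lambda>x. \<bar>x\<bar> * exp M) \<longlongrightarrow> \<bar>0\<bar> * exp M) (nhds 0)"
    by (intro tendsto_intros filterlim_ident)
  then have "\<forall>\<^sub>F x in nhds 0. \<bar>x\<bar> * exp M < \<delta>"
    using \<open>0 < \<delta>\<close> by (intro order_tendstoD) auto
  then have "\<forall>\<^sub>F x in nhds 0. \<exists>\<phi>. \<phi> 0 = x \<and> \<phi> 1 = f x \<and>
           (\<forall>t\<in>{0..1}. \<phi> t \<in> {-\<delta>..\<delta>} \<and>
              (\<phi> has_real_derivative Z (\<phi> t)) (at t within {0..1}))"
  proof eventually_elim
    case (elim x)
    have "traj x (SOME \<phi>. traj x \<phi>)" using ex[OF elim] by (rule someI_ex)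
    then show ?case unfolding traj_def f_def by blast
  qed
  then have "is_time_one_map Z f"
    using assms unfolding is_time_one_map_def by blast
  then show ?thesis unfolding time_one_map_def by (metis someI)
qed

text \<open>Two-sided Gronwall estimate through the square of \<open>\<phi>\<close>, which is
  differentiable where the modulus may not be. The lower bound keeps trajectories away from
  0.\<close>

lemma gronwall_abs:
  fixes \<phi> \<phi>' :: "real \<Rightarrow> real"
  assumes deriv: "\<And>\<tau>. \<tau> \<in> {0..1} \<Longrightarrow> (\<phi> has_real_derivative \<phi>' \<tau>) (at \<tau> within {0..1})"
    and le: "\<And>\<tau>. \<tau> \<in> {0..1} \<Longrightarrow> \<bar>\<phi>' \<tau>\<bar> \<le> K * \<bar>\<phi> \<tau>\<bar>"
    and \<tau>: "\<tau> \<in> {0..1}"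
  shows "\<bar>\<phi> 0\<bar> * exp (- (K * \<tau>)) \<le> \<bar>\<phi> \<tau>\<bar>" "\<bar>\<phi> \<tau>\<bar> \<le> \<bar>\<phi> 0\<bar> * exp (K * \<tau>)"
proof -
  have cont: "continuous_on {0..1} \<phi>" using deriv by (rule DERIV_continuous_on)
  have d: "(\<phi> has_real_derivative \<phi>' w) (at w)" if "0 < w" "w < \<tau>" for w
  proof -
    have w: "w \<in> {0..1}" "w \<in> interior {0..1}" using that \<tau> by auto
    show ?thesis using deriv[OF w(1)] unfolding at_within_interior[OF w(2)] .
  qed
  have prod: "\<bar>\<phi> w * \<phi>' w\<bar> \<le> K * (\<phi> w)\<^sup>2" if "0 < w" "w < \<tau>" for w
    using mult_left_mono[OF le[of w], of "\<bar>\<phi> w\<bar>"] that \<tau>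
    by (auto simp: abs_mult power2_eq_square mult_ac)
  \<comment> \<open>The sign \<open>e\<close> treats two claims together: the square times
    \<open>exp (2 * (K * \<tau>))\<close> does not decrease (\<open>e = 1\<close>, lower bound), and
    times \<open>exp (- (2 * (K * \<tau>)))\<close> does not increase (\<open>e = -1\<close>, upper
    bound).\<close>
  have main: "e * (\<phi> 0)\<^sup>2 \<le> e * ((\<phi> \<tau>)\<^sup>2 * exp (e * (2 * (K * \<tau>))))" if e: "e \<in> {-1, 1}" for e
  proof -
    have "e * ((\<phi> 0)\<^sup>2 * exp (e * (2 * (K * 0)))) \<le> e * ((\<phi> \<tau>)\<^sup>2 * exp (e * (2 * (K * \<tau>))))"
    proof (rule DERIV_nonneg_imp_increasing_open[of 0 \<tau>])
      fix w assume w: "0 < w" "w < \<tau>"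
      have "((\<lambda>w. e * ((\<phi> w)\<^sup>2 * exp (e * (2 * (K * w))))) has_real_derivative
        2 * exp (e * (2 * (K * w))) * (e * (\<phi> w * \<phi>' w) + (e * e) * (K * (\<phi> w)\<^sup>2))) (at w)"
        using d[OF w] by (auto intro!: derivative_eq_intros simp: algebra_simps power2_eq_square)
      moreover have "0 \<le> e * (\<phi> w * \<phi>' w) + (e * e) * (K * (\<phi> w)\<^sup>2)"
        using prod[OF w] e by auto
      ultimately show "\<exists>y. ((\<lambda>w. e * ((\<phi> w)\<^sup>2 * exp (e * (2 * (K * w))))) has_real_derivative y) (at w) \<and> 0 \<le> y"
        by fastforce
    qed (use \<tau> in \<open>auto intro!: continuous_intros continuous_on_subset[OF cont]\<close>)
    then show ?thesis by simp
  qed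
  have sq: "(\<bar>y\<bar> * exp c)\<^sup>2 = y\<^sup>2 * exp (2 * c)" for y c :: real
    by (simp add: power_mult_distrib exp_double)
  have "(\<bar>\<phi> 0\<bar>)\<^sup>2 \<le> (\<bar>\<phi> \<tau>\<bar> * exp (K * \<tau>))\<^sup>2"
    using main[of 1] unfolding sq by simp
  then have "\<bar>\<phi> 0\<bar> \<le> \<bar>\<phi> \<tau>\<bar> * exp (K * \<tau>)" by (rule power2_le_imp_le) simp
  then show "\<bar>\<phi> 0\<bar> * exp (- (K * \<tau>)) \<le> \<bar>\<phi> \<tau>\<bar>"
    by (simp add: exp_minus field_simps)
  have "(\<bar>\<phi> \<tau>\<bar> * exp (- (K * \<tau>)))\<^sup>2 \<le> (\<bar>\<phi> 0\<bar>)\<^sup>2"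
    using main[of "-1"] unfolding sq by simp
  then have "\<bar>\<phi> \<tau>\<bar> * exp (- (K * \<tau>)) \<le> \<bar>\<phi> 0\<bar>" by (rule power2_le_imp_le) simp
  then show "\<bar>\<phi> \<tau>\<bar> \<le> \<bar>\<phi> 0\<bar> * exp (K * \<tau>)"
    by (simp add: exp_minus field_simps)
qed

lemma C1_linear_bound:
  assumes "C1_on_with {-r..r} Z Z'" "Z 0 = 0" "0 < r"
  obtains K where "0 < K" "\<And>y. y \<in> {-r..r} \<Longrightarrow> \<bar>Z y\<bar> \<le> K * \<bar>y\<bar>"
proof -
  have "bounded (Z' ` {-r..r})"
    using assms unfolding C1_on_with_def
    by (intro compact_imp_bounded compact_continuous_image) auto
  then obtain K where K: "0 < K" "\<forall>y\<in>Z' ` {-r..r}. norm y \<le> K"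
    by (metis bounded_pos)
  have "\<bar>Z y\<bar> \<le> K * \<bar>y\<bar>" if "y \<in> {-r..r}" for y
    using field_differentiable_bound[of "{-r..r}" Z Z' K y 0] assms K that
    unfolding C1_on_with_def by auto
  with K show thesis using that by blast
qed

text \<open>The trajectories in \<open>is_time_one_map\<close> live in \<open>{-r..r}\<close>, with
  \<open>r\<close> unrelated to \<open>\<delta>\<close>. By Gronwall those starting close to 0 stay
  below \<open>\<delta>\<close> and never reach 0, so \<open>t_along_trajectory\<close> applies on
  one half-line.\<close>

lemma time_one_map_shifts:
  assumes lf: "line_field \<sigma> m M \<delta> Z T" and Z0: "Z 0 = 0" and \<delta>: "0 < \<delta>"
    and f: "is_time_one_map Z f"
  obtains \<epsilon> where "0 < \<epsilon>"
    "\<And>s p. \<lbrakk>s \<in> {-1, 1}; 0 < p; p < \<epsilon>\<rbrakk> \<Longrightarrow>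
       0 < s * f (s * p) \<and> s * f (s * p) < \<delta> \<and> T (f (s * p)) = T (s * p) + 1"
proof -
  obtain r Z' where r: "0 < r" "C1_on_with {-r..r} Z Z'" and
    ev: "\<forall>\<^sub>F x in nhds 0. \<exists>\<phi>. \<phi> 0 = x \<and> \<phi> 1 = f x \<and>
           (\<forall>t\<in>{0..1}. \<phi> t \<in> {-r..r} \<and>
              (\<phi> has_real_derivative Z (\<phi> t)) (at t within {0..1}))"
    using f unfolding is_time_one_map_def by blast
  obtain K where K: "0 < K" "\<And>y. y \<in> {-r..r} \<Longrightarrow> \<bar>Z y\<bar> \<le> K * \<bar>y\<bar>"
    using C1_linear_bound[OF r(2) Z0 r(1)] by blast
  obtain e where e: "0 < e" "\<And>x. \<bar>x\<bar> < e \<Longrightarrow> \<exists>\<phi>. \<phi> 0 = x \<and> \<phi> 1 = f x \<and>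
           (\<forall>t\<in>{0..1}. \<phi> t \<in> {-r..r} \<and>
              (\<phi> has_real_derivative Z (\<phi> t)) (at t within {0..1}))"
    using ev unfolding eventually_nhds_metric by (auto simp: dist_real_def)
  show thesis
  \<comment> \<open>In unit time the modulus grows at most by a factor \<open>exp K\<close>.\<close>
  proof (rule that[of "min e (\<delta> * exp (-K))"])
    fix s p :: real assume s: "s \<in> {-1, 1}" and p: "0 < p" "p < min e (\<delta> * exp (-K))"
    have s2: "s * s = 1" and sp: "\<bar>s * p\<bar> = p" using s p by auto
    obtain \<phi> where \<phi>: "\<phi> 0 = s * p" "\<phi> 1 = f (s * p)"
      "\<And>t. t \<in> {0..1} \<Longrightarrow> \<phi> t \<in> {-r..r} \<and> (\<phi> has_real_derivative Z (\<phi> t)) (at t within {0..1})"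
      using e(2)[of "s * p"] sp p by auto
    have small: "\<bar>\<phi> \<tau>\<bar> < \<delta>" and nz: "\<phi> \<tau> \<noteq> 0" if \<tau>: "\<tau> \<in> {0..1}" for \<tau>
    proof -
      have *: "p * exp (- (K * \<tau>)) \<le> \<bar>\<phi> \<tau>\<bar>" "\<bar>\<phi> \<tau>\<bar> \<le> p * exp (K * \<tau>)"
        using gronwall_abs[of \<phi> "\<lambda>t. Z (\<phi> t)" K \<tau>] \<phi> K(2) \<tau> sp by auto
      have "p * exp (K * \<tau>) \<le> p * exp K"
        using \<tau> K p by (intro mult_left_mono) auto
      also have "\<dots> < \<delta>" using p by (simp add: exp_minus field_simps)
      finally show "\<bar>\<phi> \<tau>\<bar> < \<delta>" using * by simp
      have "0 < p * exp (- (K * \<tau>))" using p by simp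
      then show "\<phi> \<tau> \<noteq> 0" using * by auto
    qed
    have cont: "continuous_on {0..1} (\<lambda>\<tau>. s * \<phi> \<tau>)"
    proof -
      have "continuous_on {0..1} \<phi>"
        by (rule DERIV_continuous_on[where D = "\<lambda>t. Z (\<phi> t)"]) (use \<phi>(3) in blast)
      then show ?thesis by (intro continuous_intros)
    qed
    \<comment> \<open>A change of sign would produce a zero, which \<open>nz\<close>
      excludes.\<close>
    have pos: "0 < s * \<phi> \<tau>" if \<tau>: "\<tau> \<in> {0..1}" for \<tau>
    proof (rule ccontr)
      assume "\<not> 0 < s * \<phi> \<tau>"
      then obtain w where "0 \<le> w" "w \<le> \<tau>" "s * \<phi> w = 0"
        using IVT2'[of "\<lambda>\<tau>. s * \<phi> \<tau>" \<tau> 0 0] \<tau> \<phi>(1) p s2 continuous_on_subset[OF cont, of "{0..\<tau>}"]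
        by (auto simp: mult.assoc[symmetric])
      then show False using nz[of w] \<tau> s by auto
    qed
    interpret half_line_field \<sigma> m M \<delta> "\<lambda>x. s * Z (s * x)" "\<lambda>x. T (s * x)"
      using lf s unfolding line_field_def by blast
    have "T (s * (s * \<phi> 1)) = T (s * (s * \<phi> 0)) + 1"
    proof (rule t_along_trajectory)
      fix \<tau> :: real assume \<tau>: "\<tau> \<in> {0..1}"
      have "((\<lambda>\<tau>. s * \<phi> \<tau>) has_real_derivative s * Z (\<phi> \<tau>)) (at \<tau> within {0..1})"
        using \<phi>(3)[OF \<tau>] by (intro DERIV_cmult) auto
      then show "0 < s * \<phi> \<tau> \<and> s * \<phi> \<tau> < \<delta> \<and>
        ((\<lambda>\<tau>. s * \<phi> \<tau>) has_real_derivative s * Z (s * (s * \<phi> \<tau>))) (at \<tau> within {0..1})"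
        using pos[OF \<tau>] small[OF \<tau>] s by auto
    qed
    then show "0 < s * f (s * p) \<and> s * f (s * p) < \<delta> \<and> T (f (s * p)) = T (s * p) + 1"
      using pos[of 1] small[of 1] \<phi> s by auto
  qed (use e \<delta> in auto)
qed

subsection \<open>Bi-Lipschitz conjugacies\<close>

lemma continuous_line_field:
  assumes "line_field \<sigma> m M \<delta> Z T"
  shows "continuous_on {y. y \<noteq> 0 \<and> \<bar>y\<bar> < \<delta>} T"
proof (rule DERIV_continuous_on)
  fix y assume "y \<in> {y. y \<noteq> 0 \<and> \<bar>y\<bar> < \<delta>}"
  then show "(T has_real_derivative 1 / Z y) (at y within {y. y \<noteq> 0 \<and> \<bar>y\<bar> < \<delta>})"
    using line_field_deriv[OF assms, of y] by (simp add: has_field_derivative_at_within)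
qed

text \<open>A continuous injection of an interval is strictly monotone, so \<open>h\<close>
  separates \<open>p\<close> and \<open>-p\<close> by \<open>h 0 = 0\<close>, whichever its
  orientation.\<close>

lemma inj_continuous_opposite_signs:
  fixes h :: "real \<Rightarrow> real"
  assumes "continuous_on {-p..p} h" "inj_on h {-p..p}" "h 0 = 0" "0 < p"
  shows "h p * h (-p) < 0"
  using continuous_inj_imp_mono[of "-p" 0 p h] assms by (auto simp: mult_less_0_iff)

text \<open>Moves the germ identity from \<open>y\<close> to \<open>x = k y\<close>, on a symmetric
  interval and with one constant for \<open>h\<close> and its inverse.\<close>

lemma bilipschitz_conjugate_local:
  assumes "bilipschitz_conjugate f g"
  obtains h \<rho> L where "0 < \<rho>" "1 \<le> L" "h 0 = 0"
    "continuous_on {-\<rho><..<\<rho>} h" "inj_on h {-\<rho><..<\<rho>}"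
    "\<And>x. \<bar>x\<bar> < \<rho> \<Longrightarrow> \<bar>h x\<bar> \<le> L * \<bar>x\<bar> \<and> \<bar>x\<bar> \<le> L * \<bar>h x\<bar> \<and> h (f x) = g (h x)"
proof -
  obtain U V h k L where U: "open U" "0 \<in> U" and hom: "homeomorphism U V h k" and h0: "h 0 = 0"
    and lip: "L-lipschitz_on U h" "L-lipschitz_on V k"
    and ev: "\<forall>\<^sub>F y in nhds 0. h (f (k y)) = g y"
    using assms unfolding bilipschitz_conjugate_def by blast
  \<comment> \<open>A constant that is at least 1 can safely divide radii, here and later.\<close>
  define L' where "L' = max 1 L"
  have L': "1 \<le> L'" and lip': "L'-lipschitz_on U h" "L'-lipschitz_on V k"
    using lip by (auto simp: L'_def intro: lipschitz_on_le)
  have kh: "k (h x) = x" "h x \<in> V" if "x \<in> U" for x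
    using hom that by (auto simp: homeomorphism_def)
  have up: "\<bar>h x\<bar> \<le> L' * \<bar>x\<bar>" if "x \<in> U" for x
    using lipschitz_onD[OF lip'(1) that U(2)] h0 by (simp add: dist_real_def)
  have low: "\<bar>x\<bar> \<le> L' * \<bar>h x\<bar>" if "x \<in> U" for x
    using lipschitz_onD[OF lip'(2) kh(2)[OF that] kh(2)[OF U(2)]] h0 kh(1)[OF that] kh(1)[OF U(2)]
    by (simp add: dist_real_def)
  obtain e where e: "0 < e" "\<And>y. \<bar>y\<bar> < e \<Longrightarrow> h (f (k y)) = g y"
    using ev unfolding eventually_nhds_metric by (auto simp: dist_real_def)
  obtain d where d: "0 < d" "ball 0 d \<subseteq> U"
    using U open_contains_ball by blast
  have inU: "x \<in> U" if "\<bar>x\<bar> < d" for x using d that by (auto simp: dist_real_def)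
  \<comment> \<open>The bound \<open>e / L'\<close> ensures \<open>\<bar>h x\<bar> < e\<close>, so
    that the identity may be used at \<open>y = h x\<close>.\<close>
  define \<rho> where "\<rho> = min d (e / L')"
  show thesis
  proof (rule that[of \<rho> L' h])
    show "0 < \<rho>" using d e L' by (simp add: \<rho>_def)
    have sub: "{-\<rho><..<\<rho>} \<subseteq> U" using inU by (auto simp: \<rho>_def)
    then show "continuous_on {-\<rho><..<\<rho>} h"
      using homeomorphism_cont1[OF hom] continuous_on_subset by blast
    show "inj_on h {-\<rho><..<\<rho>}"
      using sub kh(1) by (metis inj_on_def subsetD)
    fix x assume x: "\<bar>x\<bar> < \<rho>"
    then have xU: "x \<in> U" using inU by (simp add: \<rho>_def)
    have "L' * \<bar>x\<bar> < e" using x L' by (simp add: \<rho>_def field_simps)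
    then have "h (f (k (h x))) = g (h x)" using e up[OF xU] by simp
    then show "\<bar>h x\<bar> \<le> L' * \<bar>x\<bar> \<and> \<bar>x\<bar> \<le> L' * \<bar>h x\<bar> \<and> h (f x) = g (h x)"
      using up[OF xU] low[OF xU] kh(1)[OF xU] by simp
  qed (use L' h0 in auto)
qed

text \<open>
  A conjugacy may exchange the two half-lines, on which the antiderivatives are a priori
  unrelated; summing over \<open>\<plusminus>p\<close> makes the estimate insensitive to this.
\<close>

lemma bilipschitz_conjugate_bounded_difference:
  assumes lf: "line_field \<sigma> m M \<delta> Z T" "line_field \<sigma> m M \<delta> Z' T'"
    and Z0: "Z 0 = 0" "Z' 0 = 0" and \<delta>: "0 < \<delta>"
    and f: "is_time_one_map Z f" and g: "is_time_one_map Z' g"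
    and conj: "bilipschitz_conjugate f g"
  obtains q C where "0 < q" "q < \<delta>"
    "\<And>p. \<lbrakk>0 < p; p \<le> q\<rbrakk> \<Longrightarrow> \<bar>(T' p + T' (-p)) - (T p + T (-p))\<bar> \<le> C"
proof -
  obtain h \<rho> L where \<rho>: "0 < \<rho>" and L: "1 \<le> L" and h0: "h 0 = 0"
    and conth: "continuous_on {-\<rho><..<\<rho>} h" and injh: "inj_on h {-\<rho><..<\<rho>}"
    and h: "\<And>x. \<bar>x\<bar> < \<rho> \<Longrightarrow> \<bar>h x\<bar> \<le> L * \<bar>x\<bar> \<and> \<bar>x\<bar> \<le> L * \<bar>h x\<bar> \<and> h (f x) = g (h x)"
    by (rule bilipschitz_conjugate_local[OF conj]) (rule that; assumption)
  obtain e1 where e1: "0 < e1" "\<And>s p. \<lbrakk>s \<in> {-1, 1}; 0 < p; p < e1\<rbrakk> \<Longrightarrow>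
       0 < s * f (s * p) \<and> s * f (s * p) < \<delta> \<and> T (f (s * p)) = T (s * p) + 1"
    using time_one_map_shifts[OF lf(1) Z0(1) \<delta> f] by blast
  obtain e2 where e2: "0 < e2" "\<And>s p. \<lbrakk>s \<in> {-1, 1}; 0 < p; p < e2\<rbrakk> \<Longrightarrow>
       0 < s * g (s * p) \<and> s * g (s * p) < \<delta> \<and> T' (g (s * p)) = T' (s * p) + 1"
    using time_one_map_shifts[OF lf(2) Z0(2) \<delta> g] by blast
  \<comment> \<open>Since \<open>\<bar>h x\<bar> \<le> L * \<bar>x\<bar>\<close>, the quotients by
    \<open>L\<close> keep \<open>h x\<close> where \<open>T'\<close> and the shift property of
    \<open>g\<close> are available.\<close>
  define a where "a = min (min \<rho> (\<delta> / L)) (min e1 (e2 / L))"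
  have a: "0 < a" using \<rho> \<delta> L e1 e2 by (simp add: a_def)
  have small: "p < \<rho>" "p < \<delta>" "L * p < \<delta>" "p < e1" "L * p < e2" if "0 < p" "p < a" for p
  proof -
    show "p < \<rho>" "p < e1" "L * p < \<delta>" "L * p < e2"
      using that L by (auto simp: a_def field_simps)
    moreover have "1 * p \<le> L * p" using that L by (intro mult_right_mono) auto
    ultimately show "p < \<delta>" by simp
  qed
  have hx: "h x \<noteq> 0" "\<bar>h x\<bar> < \<delta>" "\<bar>h x\<bar> < e2" if "0 < \<bar>x\<bar>" "\<bar>x\<bar> < a" for x
    using small[OF that] h[of x] that by auto
  \<comment> \<open>Along \<open>f\<close> both \<open>T' \<circ> h\<close> and \<open>T\<close>
    gain 1, so their difference is invariant.\<close>
  have bounded: "\<exists>C. \<forall>p. 0 < p \<and> p \<le> a / 2 \<longrightarrow> \<bar>T' (h (s * p)) - T (s * p)\<bar> \<le> C"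
    if s: "s \<in> {-1, 1}" for s
  proof -
    interpret half_line_field \<sigma> m M \<delta> "\<lambda>x. s * Z (s * x)" "\<lambda>x. T (s * x)"
      using lf s unfolding line_field_def by blast
    have abs_s: "\<bar>s * p\<bar> = \<bar>p\<bar>" and s2: "s * (s * p) = p" for p :: real using s by auto
    obtain C where "\<And>p. \<lbrakk>0 < p; p \<le> a / 2\<rbrakk> \<Longrightarrow> \<bar>T' (h (s * p)) - T (s * p)\<bar> \<le> C"
    proof (rule invariant_function_bounded[where a = a and f = "\<lambda>p. s * f (s * p)"
          and u = "\<lambda>p. T' (h (s * p)) - T (s * p)"])
      have "a \<le> \<delta> / L" by (simp add: a_def)
      also have "\<delta> / L \<le> \<delta>" using L \<delta> by (simp add: field_simps)
      finally show "a \<le> \<delta>" .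
    next
      fix p assume p: "0 < p" "p < a"
      show "0 < s * f (s * p) \<and> s * f (s * p) < \<delta> \<and> T (s * (s * f (s * p))) = T (s * p) + 1"
        using e1(2)[OF s] small[OF p] p unfolding s2 by simp
    next
      fix p assume p: "0 < p" "p < a"
      define y where "y = h (s * p)"
      have y: "y \<noteq> 0" "\<bar>y\<bar> < e2" using hx[of "s * p"] p unfolding y_def abs_s by auto
      \<comment> \<open>The point \<open>y\<close> may lie on either side of 0; \<open>sgn y\<close>
        selects the half-line.\<close>
      have "T' (g (sgn y * \<bar>y\<bar>)) = T' (sgn y * \<bar>y\<bar>) + 1"
        using e2(2)[of "sgn y" "\<bar>y\<bar>"] y by (auto simp: sgn_if)
      then have "T' (g y) = T' y + 1" by (simp only: sgn_mult_abs)
      moreover have "h (f (s * p)) = g y"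
        using h[of "s * p"] small[OF p] p unfolding y_def abs_s by simp
      moreover have "T (f (s * p)) = T (s * p) + 1"
        using e1(2)[OF s] small[OF p] p by simp
      ultimately show "T' (h (s * (s * f (s * p)))) - T (s * (s * f (s * p)))
          = T' (h (s * p)) - T (s * p)"
        unfolding s2 y_def by simp
    next
      have "continuous_on {0<..<a} (\<lambda>p. h (s * p))"
      proof (rule continuous_on_compose2[OF conth])
        show "(\<lambda>p. s * p) ` {0<..<a} \<subseteq> {-\<rho><..<\<rho>}"
        proof
          fix x assume "x \<in> (\<lambda>p. s * p) ` {0<..<a}"
          then obtain p where p: "0 < p" "p < a" "x = s * p" by auto
          then have "\<bar>x\<bar> < \<rho>" using small[of p] abs_s[of p] by simp
          then show "x \<in> {-\<rho><..<\<rho>}" by auto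
        qed
      qed (intro continuous_intros)
      moreover have "(\<lambda>p. h (s * p)) ` {0<..<a} \<subseteq> {y. y \<noteq> 0 \<and> \<bar>y\<bar> < \<delta>}"
      proof
        fix x assume "x \<in> (\<lambda>p. h (s * p)) ` {0<..<a}"
        then obtain p where p: "0 < p" "p < a" "x = h (s * p)" by auto
        then show "x \<in> {y. y \<noteq> 0 \<and> \<bar>y\<bar> < \<delta>}"
          using hx[of "s * p"] abs_s[of p] by simp
      qed
      ultimately have "continuous_on {0<..<a} (\<lambda>p. T' (h (s * p)))"
        by (rule continuous_on_compose2[OF continuous_line_field[OF lf(2)]])
      moreover have "continuous_on {0<..<a} (\<lambda>p. T (s * p))"
        using small(2) by (intro continuous_t) auto
      ultimately show "continuous_on {0<..<a} (\<lambda>p. T' (h (s * p)) - T (s * p))"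
        by (rule continuous_on_diff)
    qed (use a in auto)
    then show ?thesis by blast
  qed
  obtain C1 where C1: "\<And>p. \<lbrakk>0 < p; p \<le> a / 2\<rbrakk> \<Longrightarrow> \<bar>T' (h p) - T p\<bar> \<le> C1"
    using bounded[of 1] by auto
  obtain C2 where C2: "\<And>p. \<lbrakk>0 < p; p \<le> a / 2\<rbrakk> \<Longrightarrow> \<bar>T' (h (-p)) - T (-p)\<bar> \<le> C2"
    using bounded[of "-1"] by auto
  show thesis
  proof (rule that[of "a / 2" "C1 + C2 + 2 * (ln L / m)"])
    show "0 < a / 2" using a by simp
    then show "a / 2 < \<delta>" using small(2)[of "a / 2"] by simp
    fix p assume p: "0 < p" "p \<le> a / 2"
    then have pa: "p < a" by simp
    note sm = small[OF p(1) pa]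
    have "h p * h (-p) < 0"
    proof (rule inj_continuous_opposite_signs)
      have sub: "{-p..p} \<subseteq> {-\<rho><..<\<rho>}" using sm by auto
      show "continuous_on {-p..p} h" using conth sub by (rule continuous_on_subset)
      show "inj_on h {-p..p}" using injh sub by (rule inj_on_subset)
    qed (use h0 p in auto)
    moreover have cmp: "\<bar>T' (h x) - T' y\<bar> \<le> ln L / m" if "0 < h x * y" "\<bar>x\<bar> = p" "\<bar>y\<bar> = p" for x y
      using line_field_compare[OF lf(2), of "h x" y L] that h[of x] hx[of x] sm L p pa by simp
    \<comment> \<open>Either \<open>h\<close> keeps each half-line or it exchanges them. In both
      cases the sums of \<open>T' \<circ> h\<close> and of \<open>T'\<close> over \<open>p\<close>
      and \<open>-p\<close> differ by at most \<open>2 * (ln L / m)\<close>.\<close>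
    ultimately consider "\<bar>T' (h p) - T' p\<bar> \<le> ln L / m" "\<bar>T' (h (-p)) - T' (-p)\<bar> \<le> ln L / m"
      | "\<bar>T' (h p) - T' (-p)\<bar> \<le> ln L / m" "\<bar>T' (h (-p)) - T' p\<bar> \<le> ln L / m"
      using cmp[of p p] cmp[of p "-p"] cmp[of "-p" p] cmp[of "-p" "-p"] p
      by (auto simp: mult_less_0_iff zero_less_mult_iff)
    then show "\<bar>(T' p + T' (-p)) - (T p + T (-p))\<bar> \<le> C1 + C2 + 2 * (ln L / m)"
      using C1[OF p] C2[OF p] by cases linarith+
  qed
qed

section \<open>Divergence of the time coordinates\<close>

text \<open>The derivative of \<open>D\<close> is at most \<open>\<kappa> / (p * ln p)\<close>, the
  derivative of \<open>\<kappa> * ln (- ln p)\<close>. Hence \<open>D\<close> grows at least like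
  this iterated logarithm as \<open>p\<close> decreases to 0.\<close>

lemma unbounded_difference:
  assumes lf: "line_field \<sigma> m M \<delta> (\<lambda>x. X x + \<alpha> * W x) T" "line_field \<sigma> m M \<delta> (\<lambda>x. X x + \<beta> * W x) T'"
    and W: "\<And>x. W x = - x / ln x" and \<delta>: "\<delta> < 1" and less: "\<alpha> < \<beta>"
    and q: "0 < q" "q < \<delta>"
    and C: "\<And>p. \<lbrakk>0 < p; p \<le> q\<rbrakk> \<Longrightarrow> \<bar>(T' p + T' (-p)) - (T p + T (-p))\<bar> \<le> C"
  shows False
proof -
  define D where "D p = (T' p + T' (-p)) - (T p + T (-p))" for p
  \<comment> \<open>Each half-line contributes \<open>(\<beta> - \<alpha>) / M\<^sup>2\<close>,
    whence the factor 2.\<close>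
  define \<kappa> where "\<kappa> = 2 * (\<beta> - \<alpha>) / M\<^sup>2"
  interpret P: half_line_field \<sigma> m M \<delta> "\<lambda>x. 1 * (X (1 * x) + \<alpha> * W (1 * x))" "\<lambda>x. T (1 * x)"
    using lf unfolding line_field_def by blast
  have "0 < \<kappa>" using less P.M_pos by (simp add: \<kappa>_def)
  have slope: "1 / (s * (X (s * p) + \<beta> * W (s * p))) - 1 / (s * (X (s * p) + \<alpha> * W (s * p)))
      \<le> \<kappa> / 2 * (1 / (p * ln p))" if s: "s \<in> {-1, 1}" and p: "0 < p" "p < \<delta>" for s p
  proof -
    interpret A: half_line_field \<sigma> m M \<delta> "\<lambda>x. s * (X (s * x) + \<alpha> * W (s * x))" "\<lambda>x. T (s * x)"
      using lf s unfolding line_field_def by blast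
    interpret B: half_line_field \<sigma> m M \<delta> "\<lambda>x. s * (X (s * x) + \<beta> * W (s * x))" "\<lambda>x. T' (s * x)"
      using lf s unfolding line_field_def by blast
    define za where "za = s * (X (s * p) + \<alpha> * W (s * p))"
    define zb where "zb = s * (X (s * p) + \<beta> * W (s * p))"
    have ln: "ln p < 0" using p \<delta> by simp
    have pos: "0 < \<sigma> * za" "0 < \<sigma> * zb" "\<sigma> * za \<le> M * p" "\<sigma> * zb \<le> M * p"
      using A.lower[OF p] A.upper[OF p] B.lower[OF p] B.upper[OF p] p A.m_pos
      unfolding za_def zb_def by (smt (verit) mult_pos_pos)+
    have sq: "\<sigma> * \<sigma> = 1" using A.sigma_cases by auto
    \<comment> \<open>The product \<open>za * zb\<close> is positive for either sign of the
      multiplier, so the direction of divergence does not depend on \<open>\<sigma>\<close>.\<close>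
    have "(\<sigma> * za) * (\<sigma> * zb) = (\<sigma> * \<sigma>) * (za * zb)" by (simp only: mult_ac)
    then have prod: "za * zb = (\<sigma> * za) * (\<sigma> * zb)" using sq by simp
    have "za * zb \<le> (M * p) * (M * p)"
      unfolding prod by (rule mult_mono[OF pos(3,4) _ less_imp_le[OF pos(2)]]) (use p P.M_pos in simp)
    moreover have "0 < za * zb"
      unfolding prod by (rule mult_pos_pos[OF pos(1,2)])
    ultimately have bnd: "0 < za * zb" "za * zb \<le> M\<^sup>2 * p\<^sup>2" by (auto simp: power2_eq_square mult_ac)
    have "za - zb = (\<beta> - \<alpha>) * (p / ln p)"
    proof -
      \<comment> \<open>\<open>W\<close> is odd because \<open>ln\<close> is even; the contributions
        of the two half-lines therefore have the same sign and cannot cancel.\<close>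
      have "s * W (s * p) = - (p / ln p)" using s by (auto simp: W ln_minus)
      moreover have "za - zb = (\<alpha> - \<beta>) * (s * W (s * p))"
        by (simp add: za_def zb_def algebra_simps)
      ultimately have "za - zb = (\<alpha> - \<beta>) * - (p / ln p)" by (simp only:)
      also have "\<dots> = (\<beta> - \<alpha>) * (p / ln p)" by (simp only: left_diff_distrib)
      finally show ?thesis .
    qed
    moreover have "1 / zb - 1 / za = (za - zb) / (za * zb)"
    proof -
      have "za \<noteq> 0" "zb \<noteq> 0" using bnd by auto
      then show ?thesis by (simp add: field_simps)
    qed
    ultimately have "1 / zb - 1 / za = (\<beta> - \<alpha>) * (p / ln p) / (za * zb)" by simp
    \<comment> \<open>The numerator is negative, so a larger denominator increases the
      quotient.\<close>
    also have "\<dots> \<le> (\<beta> - \<alpha>) * (p / ln p) / (M\<^sup>2 * p\<^sup>2)"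
    proof (rule divide_left_mono_neg[OF bnd(2)])
      show "(\<beta> - \<alpha>) * (p / ln p) \<le> 0"
        using less p ln by (intro mult_nonneg_nonpos divide_nonneg_neg) simp_all
      show "0 < za * zb * (M\<^sup>2 * p\<^sup>2)"
        by (rule mult_pos_pos[OF bnd(1)]) (use p P.M_pos in simp)
    qed
    also have "\<dots> = \<kappa> / 2 * (1 / (p * ln p))"
      using p ln P.M_pos by (simp add: \<kappa>_def field_simps power2_eq_square)
    finally show ?thesis unfolding za_def zb_def .
  qed
  have mono: "D q - \<kappa> * ln (- ln q) \<le> D p - \<kappa> * ln (- ln p)" if p: "0 < p" "p \<le> q" for p
  proof (rule DERIV_nonpos_imp_nonincreasing[OF p(2)])
    fix w assume "p \<le> w" "w \<le> q"
    then have w: "0 < w" "w < \<delta>" "ln w < 0" using p q \<delta> by auto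
    have dT: "((\<lambda>w. S (s * w)) has_real_derivative 1 / (s * Z (s * w))) (at w)"
      if "line_field \<sigma> m M \<delta> Z S" "s \<in> {-1, 1}" for Z S s
      using that half_line_field.deriv_t[of \<sigma> m M \<delta> "\<lambda>x. s * Z (s * x)" "\<lambda>x. S (s * x)" w] w
      unfolding line_field_def by blast
    let ?d = "\<lambda>s. 1 / (s * (X (s * w) + \<beta> * W (s * w))) - 1 / (s * (X (s * w) + \<alpha> * W (s * w)))"
    have dD: "(D has_real_derivative ?d 1 + ?d (-1)) (at w)"
    proof -
      have "((\<lambda>w. (T' (1 * w) + T' (-1 * w)) - (T (1 * w) + T (-1 * w))) has_real_derivative
          (1 / (1 * (X (1 * w) + \<beta> * W (1 * w))) + 1 / (-1 * (X (-1 * w) + \<beta> * W (-1 * w))))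
          - (1 / (1 * (X (1 * w) + \<alpha> * W (1 * w))) + 1 / (-1 * (X (-1 * w) + \<alpha> * W (-1 * w))))) (at w)"
        by (intro DERIV_diff DERIV_add dT[OF lf(1)] dT[OF lf(2)]) auto
      then show ?thesis unfolding D_def[abs_def] by (simp add: algebra_simps)
    qed
    have "((\<lambda>w. \<kappa> * ln (- ln w)) has_real_derivative \<kappa> * (1 / (w * ln w))) (at w)"
      using w by (auto intro!: derivative_eq_intros simp: field_simps)
    from DERIV_diff[OF dD this]
    have "((\<lambda>p. D p - \<kappa> * ln (- ln p)) has_real_derivative ?d 1 + ?d (-1) - \<kappa> * (1 / (w * ln w))) (at w)" .
    moreover have "?d 1 + ?d (-1) - \<kappa> * (1 / (w * ln w)) \<le> 0"
    proof -
      have "?d 1 \<le> \<kappa> / 2 * (1 / (w * ln w))" "?d (-1) \<le> \<kappa> / 2 * (1 / (w * ln w))"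
        using slope w by blast+
      moreover have "\<kappa> / 2 * (1 / (w * ln w)) + \<kappa> / 2 * (1 / (w * ln w)) = \<kappa> * (1 / (w * ln w))"
        by simp
      ultimately show ?thesis by linarith
    qed
    ultimately show "\<exists>y. ((\<lambda>p. D p - \<kappa> * ln (- ln p)) has_real_derivative y) (at w) \<and> y \<le> 0" by blast
  qed
  \<comment> \<open>\<open>p\<close> solves \<open>ln (- ln p) = B\<close>. From \<open>q\<close> to
    \<open>p\<close> the function \<open>D\<close> then rises by at least
    \<open>2 * \<bar>C\<bar> + \<kappa>\<close>, too much for two values of modulus at most
    \<open>C\<close>.\<close>
  define B where "B = ln (- ln q) + 2 * \<bar>C\<bar> / \<kappa> + 1"
  define p where "p = exp (- exp B)"
  have lnq: "ln q < 0" using q \<delta> by simp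
  have "- ln q = exp (ln (- ln q))" using lnq by simp
  also have "\<dots> \<le> exp B" using \<open>0 < \<kappa>\<close> by (simp add: B_def)
  finally have "exp (- exp B) \<le> exp (ln q)" by simp
  then have p: "0 < p" "p \<le> q" using q by (auto simp: p_def)
  have "ln (- ln p) = B" by (simp add: p_def)
  then have "D q - \<kappa> * ln (- ln q) \<le> D p - \<kappa> * B" using mono[OF p] by simp
  moreover have "\<kappa> * B = \<kappa> * ln (- ln q) + 2 * \<bar>C\<bar> + \<kappa>"
    using \<open>0 < \<kappa>\<close> by (simp add: B_def field_simps)
  moreover have "\<bar>D q\<bar> \<le> C" "\<bar>D p\<bar> \<le> C" using C p q by (auto simp: D_def)
  ultimately show False using \<open>0 < \<kappa>\<close> by linarith
qed

subsection \<open>The logarithmic perturbation\<close>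

lemma DERIV_ln_nonzero:
  fixes x :: real
  assumes "x \<noteq> 0"
  shows "(ln has_real_derivative 1 / x) (at x)"
proof (cases "0 < x")
  case True
  then show ?thesis by (rule DERIV_ln_divide)
next
  case False
  then have "0 < - x" using assms by simp
  have "((\<lambda>y. ln (- y)) has_real_derivative 1 / (- x) * - 1) (at x)"
    by (rule DERIV_chain2[of ln]) (auto intro!: DERIV_ln_divide derivative_eq_intros \<open>0 < - x\<close>)
  then show ?thesis by (simp add: ln_minus)
qed

lemma inverse_ln_tendsto_0: "((\<lambda>x::real. 1 / ln x) \<longlongrightarrow> 0) (at 0)"
proof -
  have r: "((\<lambda>x::real. 1 / ln x) \<longlongrightarrow> 0) (at_right 0)"
    using filterlim_compose[OF tendsto_inverse_0 filterlim_mono[OF ln_at_0 at_bot_le_at_infinity order_refl]]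
    by (simp add: divide_inverse)
  have "((\<lambda>x::real. 1 / ln x) \<longlongrightarrow> 0) (at_left 0)"
    using r by (simp add: filterlim_at_left_to_right ln_minus)
  from filterlim_split_at[OF this r] show ?thesis .
qed

text \<open>
  Isabelle's \<open>ln\<close> is even with \<open>ln 0 = 0\<close>, so these formulas cover all three cases
  \<open>x < 0\<close>, \<open>x = 0\<close> and \<open>x > 0\<close>.
\<close>

lemma C1_on_with_log_perturbation:
  assumes "\<delta> < 1"
  shows "C1_on_with {-\<delta>..\<delta>} (\<lambda>x. - x / ln x) (\<lambda>x. 1 / (ln x)\<^sup>2 - 1 / ln x)"
proof -
  have d: "((\<lambda>x. - x / ln x) has_real_derivative 1 / (ln x)\<^sup>2 - 1 / ln x) (at x)"
    and c: "isCont (\<lambda>x. 1 / (ln x)\<^sup>2 - 1 / ln x) x" if x: "x \<in> {-\<delta>..\<delta>}" for x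
  proof -
    have "((\<lambda>x. - x / ln x) has_real_derivative 1 / (ln x)\<^sup>2 - 1 / ln x) (at x)
      \<and> isCont (\<lambda>x. 1 / (ln x)\<^sup>2 - 1 / ln x) x"
    proof (cases "x = 0")
      case True
      \<comment> \<open>The difference quotient at 0 is \<open>- (1 / ln h)\<close>, so the
        derivative is 0. The formula for the derivative takes this value by \<open>ln 0 = 0\<close>
        and division by 0 giving 0.\<close>
      have "((\<lambda>h. (- (0 + h) / ln (0 + h) - (- 0 / ln 0)) / h) \<longlongrightarrow> - 0) (at (0::real))"
      proof (rule Lim_transform_eventually)
        show "((\<lambda>h::real. - (1 / ln h)) \<longlongrightarrow> - 0) (at 0)"
          by (intro tendsto_minus inverse_ln_tendsto_0)
        show "\<forall>\<^sub>F h in at (0::real). - (1 / ln h) = (- (0 + h) / ln (0 + h) - (- 0 / ln 0)) / h"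
          by (auto simp: eventually_at_filter)
      qed
      moreover have "((\<lambda>x::real. (1 / ln x) ^ 2 - 1 / ln x) \<longlongrightarrow> 0 ^ 2 - 0) (at 0)"
        by (intro tendsto_intros inverse_ln_tendsto_0)
      ultimately show ?thesis
        using True by (simp add: DERIV_def isCont_def power_one_over)
    next
      case False
      \<comment> \<open>Bounding \<open>\<delta>\<close> by 1 keeps the interval off the zeros 1 and
        -1 of \<open>ln\<close>.\<close>
      have "\<bar>x\<bar> < 1" using x assms by auto
      then have "ln x \<noteq> 0" using False exp_ln_abs[of x] by auto
      have "((\<lambda>x. - x / ln x) has_real_derivative (- 1 * ln x - - x * (1 / x)) / (ln x * ln x)) (at x)"
        by (intro DERIV_divide DERIV_minus DERIV_ident DERIV_ln_nonzero False \<open>ln x \<noteq> 0\<close>)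
      then have "((\<lambda>x. - x / ln x) has_real_derivative 1 / (ln x)\<^sup>2 - 1 / ln x) (at x)"
        by (rule DERIV_cong) (use False \<open>ln x \<noteq> 0\<close> in \<open>simp add: field_simps power2_eq_square\<close>)
      moreover have "isCont (\<lambda>x. 1 / (ln x)\<^sup>2 - 1 / ln x) x"
        using False \<open>ln x \<noteq> 0\<close> by (intro continuous_intros) auto
      ultimately show ?thesis ..
    qed
    then show "((\<lambda>x. - x / ln x) has_real_derivative 1 / (ln x)\<^sup>2 - 1 / ln x) (at x)"
      "isCont (\<lambda>x. 1 / (ln x)\<^sup>2 - 1 / ln x) x" by auto
  qed
  show ?thesis
    unfolding C1_on_with_def
  proof (intro conjI ballI)
    fix x assume "x \<in> {-\<delta>..\<delta>}"
    then show "((\<lambda>x. - x / ln x) has_real_derivative 1 / (ln x)\<^sup>2 - 1 / ln x) (at x within {-\<delta>..\<delta>})"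
      by (rule has_field_derivative_at_within[OF d])
  next
    show "continuous_on {-\<delta>..\<delta>} (\<lambda>x. 1 / (ln x)\<^sup>2 - 1 / ln x)"
      using c by (intro continuous_at_imp_continuous_on ballI)
  qed
qed

section \<open>Fields depending affinely on a parameter\<close>

lemma C1_on_with_subset: "\<lbrakk>C1_on_with S X X'; A \<subseteq> S\<rbrakk> \<Longrightarrow> C1_on_with A X X'"
  unfolding C1_on_with_def by (meson DERIV_subset continuous_on_subset subsetD)

lemma C1_on_with_continuous_on: "C1_on_with S X X' \<Longrightarrow> continuous_on S X"
  unfolding C1_on_with_def by (metis DERIV_continuous_on)

lemma C1_on_with_affine:
  assumes "C1_on_with S X X'" "C1_on_with S W W'"
  shows "C1_on_with S (\<lambda>x. X x + \<alpha> * W x) (\<lambda>x. X' x + \<alpha> * W' x)"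
  using assms unfolding C1_on_with_def
  by (intro conjI ballI DERIV_add DERIV_cmult continuous_intros) auto

text \<open>The uniform distance is at most \<open>\<bar>\<beta> - \<alpha>\<bar>\<close> times a
  bound for \<open>g\<close> on the compact set. It serves for the fields and for their
  derivatives.\<close>

lemma uniform_limit_affine:
  fixes f g :: "real \<Rightarrow> real"
  assumes "compact S" "continuous_on S g"
  shows "uniform_limit S (\<lambda>\<alpha> x. f x + \<alpha> * g x) (\<lambda>x. f x + \<alpha> * g x) (at \<alpha> within I)"
proof -
  have "bounded (g ` S)"
    using assms by (intro compact_imp_bounded compact_continuous_image)
  then obtain B where B: "0 < B" "\<forall>y\<in>g ` S. norm y \<le> B"
    by (metis bounded_pos)
  show ?thesis
  proof (rule uniform_limitI)
    fix e :: real assume "0 < e"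
    then have "\<forall>\<^sub>F \<beta> in at \<alpha> within I. dist \<beta> \<alpha> < e / B"
      using B by (auto simp: eventually_at intro!: exI[of _ "e / B"])
    then show "\<forall>\<^sub>F \<beta> in at \<alpha> within I. \<forall>x\<in>S. dist (f x + \<beta> * g x) (f x + \<alpha> * g x) < e"
    proof eventually_elim
      case (elim \<beta>)
      show ?case
      proof
        fix x assume "x \<in> S"
        have "dist (f x + \<beta> * g x) (f x + \<alpha> * g x) = \<bar>\<beta> - \<alpha>\<bar> * \<bar>g x\<bar>"
          by (simp add: dist_real_def abs_mult[symmetric] algebra_simps)
        also have "\<dots> \<le> \<bar>\<beta> - \<alpha>\<bar> * B"
          using B \<open>x \<in> S\<close> by (intro mult_left_mono) auto
        also have "\<dots> < e" using elim B by (simp add: dist_real_def field_simps)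
        finally show "dist (f x + \<beta> * g x) (f x + \<alpha> * g x) < e" .
      qed
    qed
  qed
qed

lemma C1_on_with_deriv_0:
  assumes "C1_on_with {-r..r} Z Z'" "0 < r"
  shows "(Z has_real_derivative Z' 0) (at 0)"
proof -
  have "(Z has_real_derivative Z' 0) (at 0 within {-r..r})"
    using assms unfolding C1_on_with_def by auto
  moreover have "at 0 within {-r..r} = at (0::real)"
    using assms by (intro at_within_interior) auto
  ultimately show ?thesis by simp
qed

lemma C1_on_with_multiplier: "\<lbrakk>C1_on_with {-r..r} Z Z'; 0 < r\<rbrakk> \<Longrightarrow> multiplier Z = Z' 0"
  unfolding multiplier_def by (intro DERIV_imp_deriv C1_on_with_deriv_0)

lemma C1_first_order_estimate:
  assumes "C1_on_with {-r..r} Z Z'" "0 < r" "Z 0 = 0" "0 < e"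
  obtains d where "0 < d" "\<And>x. \<bar>x\<bar> < d \<Longrightarrow> \<bar>Z x - Z' 0 * x\<bar> \<le> e * \<bar>x\<bar>"
proof -
  have "(Z has_derivative (\<lambda>x. Z' 0 * x)) (at 0)"
    using C1_on_with_deriv_0[OF assms(1,2)] by (simp add: has_field_derivative_def)
  then obtain d where "0 < d" "\<And>x. \<bar>x\<bar> < d \<Longrightarrow> \<bar>Z x - Z' 0 * x\<bar> \<le> e * \<bar>x\<bar>"
    using assms unfolding has_derivative_at_alt by auto
  then show thesis by (rule that)
qed

section \<open>The path through a given germ\<close>

theorem theoremA:
  fixes X :: "real \<Rightarrow> real"
  assumes "hyperbolic_C1_germ X"
  shows "\<exists>(I :: real set) (Y :: real \<Rightarrow> real \<Rightarrow> real).
           C1_continuous_path I Y \<and>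
           (\<exists>\<alpha>\<in>I. germ_eq (Y \<alpha>) X) \<and>
           (\<forall>\<alpha>\<in>I. hyperbolic_C1_germ (Y \<alpha>)) \<and>
           (\<forall>\<alpha>\<in>I. \<forall>\<beta>\<in>I. multiplier (Y \<alpha>) = multiplier (Y \<beta>)) \<and>
           (\<forall>\<alpha>\<in>I. \<forall>\<beta>\<in>I. \<alpha> \<noteq> \<beta> \<longrightarrow>
              \<not> bilipschitz_conjugate (time_one_map (Y \<alpha>)) (time_one_map (Y \<beta>)))"
proof -
  define W :: "real \<Rightarrow> real" where "W x = - x / ln x" for x
  define W' :: "real \<Rightarrow> real" where "W' x = 1 / (ln x)\<^sup>2 - 1 / ln x" for x
  \<comment> \<open>The vanishing of \<open>W' 0\<close> keeps the multiplier constant along the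
    path.\<close>
  have W0: "W 0 = 0" "W' 0 = 0" by (auto simp: W_def W'_def)
  have W_C1: "C1_on_with {-r..r} W W'" if "r < 1" for r
    using C1_on_with_log_perturbation[OF that] unfolding W_def[abs_def] W'_def[abs_def] .
  obtain r X' where r: "0 < r" and X_C1: "C1_on_with {-r..r} X X'" and X0: "X 0 = 0"
    using assms unfolding hyperbolic_C1_germ_def C1_germ_def by auto
  define \<mu> where "\<mu> = X' 0"
  define \<sigma> where "\<sigma> = sgn \<mu>"
  have "\<mu> \<noteq> 0"
    using assms C1_on_with_multiplier[OF X_C1 r] unfolding hyperbolic_C1_germ_def \<mu>_def by simp
  \<comment> \<open>A quarter for \<open>X\<close> and, as \<open>\<alpha> \<in> {0..1}\<close>, a
    quarter for \<open>\<alpha> * W\<close>: the total deviation from \<open>\<mu> * x\<close> is at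
    most \<open>\<bar>\<mu>\<bar> / 2 * \<bar>x\<bar>\<close>.\<close>
  then have e: "0 < \<bar>\<mu>\<bar> / 4" by simp
  obtain d1 where d1: "0 < d1" "\<And>x. \<bar>x\<bar> < d1 \<Longrightarrow> \<bar>X x - \<mu> * x\<bar> \<le> \<bar>\<mu>\<bar> / 4 * \<bar>x\<bar>"
    using C1_first_order_estimate[OF X_C1 r X0 e] unfolding \<mu>_def by blast
  obtain d2 where d2: "0 < d2" "\<And>x. \<bar>x\<bar> < d2 \<Longrightarrow> \<bar>W x - 0 * x\<bar> \<le> \<bar>\<mu>\<bar> / 4 * \<bar>x\<bar>"
    using C1_first_order_estimate[OF W_C1[of "1/2"] _ W0(1) e] unfolding W0 by auto
  define \<delta> where "\<delta> = min (min r (1 / 2)) (min d1 d2)"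
  have \<delta>: "0 < \<delta>" "\<delta> < 1" "\<delta> \<le> r" "\<delta> \<le> d1" "\<delta> \<le> d2"
    using r d1 d2 by (auto simp: \<delta>_def)
  define Y where "Y \<alpha> x = X x + \<alpha> * W x" for \<alpha> x
  define Y' where "Y' \<alpha> x = X' x + \<alpha> * W' x" for \<alpha> x
  have C1: "C1_on_with {-\<delta>..\<delta>} X X'" "C1_on_with {-\<delta>..\<delta>} W W'"
    using C1_on_with_subset[OF X_C1, of "{-\<delta>..\<delta>}"] W_C1[OF \<delta>(2)] \<delta> by auto
  have Y_C1: "C1_on_with {-\<delta>..\<delta>} (Y \<alpha>) (Y' \<alpha>)" for \<alpha>
    using C1_on_with_affine[OF C1] unfolding Y_def[abs_def] Y'_def[abs_def] .
  have Y0: "Y \<alpha> 0 = 0" "Y' \<alpha> 0 = \<mu>" for \<alpha>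
    using X0 W0 by (auto simp: Y_def Y'_def \<mu>_def)
  \<comment> \<open>The constants and \<open>\<delta>\<close> are common to all
    \<open>\<alpha>\<close>, so that any two fields of the path can be compared.\<close>
  have lf: "\<exists>T. line_field \<sigma> (\<bar>\<mu>\<bar> / 2) (3 * \<bar>\<mu>\<bar> / 2) \<delta> (Y \<alpha>) T" if \<alpha>: "\<alpha> \<in> {0..1}" for \<alpha>
  proof -
    have bounds: "\<bar>\<mu>\<bar> / 2 * x\<^sup>2 \<le> \<sigma> * (x * Y \<alpha> x) \<and> \<sigma> * (x * Y \<alpha> x) \<le> 3 * \<bar>\<mu>\<bar> / 2 * x\<^sup>2"
      if x: "\<bar>x\<bar> < \<delta>" for x
    proof -
      have "\<bar>\<alpha> * W x\<bar> \<le> 1 * \<bar>W x\<bar>"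
        unfolding abs_mult using \<alpha> by (intro mult_right_mono) auto
      also have "\<dots> \<le> \<bar>\<mu>\<bar> / 4 * \<bar>x\<bar>" using d2(2)[of x] x \<delta>(5) by simp
      finally have "\<bar>(X x - \<mu> * x) + \<alpha> * W x\<bar> \<le> \<bar>\<mu>\<bar> / 4 * \<bar>x\<bar> + \<bar>\<mu>\<bar> / 4 * \<bar>x\<bar>"
        using d1(2)[of x] x \<delta>(4) by (intro order_trans[OF abs_triangle_ineq] add_mono) auto
      then have "\<bar>Y \<alpha> x - \<mu> * x\<bar> \<le> \<bar>\<mu>\<bar> / 4 * \<bar>x\<bar> + \<bar>\<mu>\<bar> / 4 * \<bar>x\<bar>"
        by (simp add: Y_def algebra_simps)
      then have "\<bar>x\<bar> * \<bar>Y \<alpha> x - \<mu> * x\<bar> \<le> \<bar>x\<bar> * (\<bar>\<mu>\<bar> / 2 * \<bar>x\<bar>)"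
        by (intro mult_left_mono) auto
      then have "\<bar>\<sigma> * (x * (Y \<alpha> x - \<mu> * x))\<bar> \<le> \<bar>\<mu>\<bar> / 2 * x\<^sup>2"
        using \<open>\<mu> \<noteq> 0\<close> by (simp add: \<sigma>_def abs_mult power2_eq_square abs_sgn_eq mult_ac)
      moreover have "\<sigma> * (x * (Y \<alpha> x - \<mu> * x)) = \<sigma> * (x * Y \<alpha> x) - \<bar>\<mu>\<bar> * x\<^sup>2"
        by (simp add: \<sigma>_def abs_sgn power2_eq_square algebra_simps)
      ultimately have "\<bar>\<sigma> * (x * Y \<alpha> x) - \<bar>\<mu>\<bar> * x\<^sup>2\<bar> \<le> (\<bar>\<mu>\<bar> * x\<^sup>2) / 2" by simp
      then have "(\<bar>\<mu>\<bar> * x\<^sup>2) / 2 \<le> \<sigma> * (x * Y \<alpha> x)" "\<sigma> * (x * Y \<alpha> x) \<le> 3 * (\<bar>\<mu>\<bar> * x\<^sup>2) / 2"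
        by linarith+
      then show ?thesis by simp
    qed
    show ?thesis
    proof (rule line_field_exists[of \<sigma> "\<bar>\<mu>\<bar> / 2" "3 * \<bar>\<mu>\<bar> / 2" \<delta> "Y \<alpha>"])
      fix x assume "\<bar>x\<bar> < \<delta>"
      then have "x \<in> interior {-\<delta>..\<delta>}" by auto
      then show "isCont (Y \<alpha>) x"
        using continuous_on_interior[OF C1_on_with_continuous_on[OF Y_C1]] by blast
    next
      show "\<bar>\<sigma>\<bar> = 1" using \<open>\<mu> \<noteq> 0\<close> by (simp add: \<sigma>_def abs_sgn_eq)
    next
      fix T assume "line_field \<sigma> (\<bar>\<mu>\<bar> / 2) (3 * \<bar>\<mu>\<bar> / 2) \<delta> (Y \<alpha>) T"
      then show ?thesis by blast
    qed (use \<open>\<mu> \<noteq> 0\<close> \<delta>(1) bounds in simp_all)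
  qed
  have not_conj: "\<not> bilipschitz_conjugate (time_one_map (Y \<alpha>)) (time_one_map (Y \<beta>))"
    if \<alpha>\<beta>: "\<alpha> \<in> {0..1}" "\<beta> \<in> {0..1}" "\<alpha> \<noteq> \<beta>" for \<alpha> \<beta>
  proof
    assume conj: "bilipschitz_conjugate (time_one_map (Y \<alpha>)) (time_one_map (Y \<beta>))"
    obtain T where T: "line_field \<sigma> (\<bar>\<mu>\<bar> / 2) (3 * \<bar>\<mu>\<bar> / 2) \<delta> (Y \<alpha>) T"
      using lf \<alpha>\<beta> by blast
    obtain T' where T': "line_field \<sigma> (\<bar>\<mu>\<bar> / 2) (3 * \<bar>\<mu>\<bar> / 2) \<delta> (Y \<beta>) T'"
      using lf \<alpha>\<beta> by blast
    obtain q C where q: "0 < q" "q < \<delta>"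
      and C: "\<And>p. \<lbrakk>0 < p; p \<le> q\<rbrakk> \<Longrightarrow> \<bar>(T' p + T' (-p)) - (T p + T (-p))\<bar> \<le> C"
      by (rule bilipschitz_conjugate_bounded_difference[OF T T' Y0(1) Y0(1) \<delta>(1)
            time_one_map_exists[OF T Y_C1 Y0(1) \<delta>(1)] time_one_map_exists[OF T' Y_C1 Y0(1) \<delta>(1)] conj])
        (rule that; assumption)
    have C': "\<bar>(T p + T (-p)) - (T' p + T' (-p))\<bar> \<le> C" if "0 < p" "p \<le> q" for p
      using C[OF that] by (simp add: abs_minus_commute)
    note T = T[unfolded Y_def[abs_def]] and T' = T'[unfolded Y_def[abs_def]]
    \<comment> \<open>The growth estimate takes an ordered pair of parameters; if
      \<open>\<beta> < \<alpha>\<close>, then \<open>T\<close> and \<open>T'\<close> exchange roles,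
      with \<open>C'\<close> in place of \<open>C\<close>.\<close>
    from \<alpha>\<beta>(3) consider "\<alpha> < \<beta>" | "\<beta> < \<alpha>" by linarith
    then show False
    proof cases
      case 1
      from unbounded_difference[OF T T' W_def \<delta>(2) 1 q C] show False .
    next
      case 2
      from unbounded_difference[OF T' T W_def \<delta>(2) 2 q C'] show False .
    qed
  qed
  have "C1_continuous_path {0..1} Y"
    unfolding C1_continuous_path_def
  proof (intro conjI)
    show "\<exists>a\<in>{0..1::real}. \<exists>b\<in>{0..1}. a \<noteq> b"
      by (intro bexI[of _ 0] bexI[of _ 1]) auto
    have "uniform_limit {-\<delta>..\<delta>} Y (Y \<alpha>) (at \<alpha> within {0..1})" for \<alpha>
      using uniform_limit_affine[OF compact_Icc C1_on_with_continuous_on[OF C1(2)]]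
      unfolding Y_def[abs_def] .
    moreover have "uniform_limit {-\<delta>..\<delta>} Y' (Y' \<alpha>) (at \<alpha> within {0..1})" for \<alpha>
      using uniform_limit_affine[OF compact_Icc, of "-\<delta>" \<delta> W'] C1(2)
      unfolding Y'_def[abs_def] C1_on_with_def by blast
    ultimately show "\<exists>\<delta>>0. \<exists>Z Z'. \<forall>\<alpha>\<in>{0..1}. germ_eq (Z \<alpha>) (Y \<alpha>) \<and>
        C1_on_with {-\<delta>..\<delta>} (Z \<alpha>) (Z' \<alpha>) \<and>
        uniform_limit {-\<delta>..\<delta>} Z (Z \<alpha>) (at \<alpha> within {0..1}) \<and>
        uniform_limit {-\<delta>..\<delta>} Z' (Z' \<alpha>) (at \<alpha> within {0..1})"
      using \<delta>(1) Y_C1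
      by (intro exI[of _ \<delta>] conjI exI[of _ Y] exI[of _ Y']) (auto simp: germ_eq_def)
  qed (rule is_interval_cc)
  moreover have "germ_eq (Y 0) X"
    by (simp add: germ_eq_def Y_def)
  moreover have "multiplier (Y \<alpha>) = \<mu>" for \<alpha>
    using C1_on_with_multiplier[OF Y_C1 \<delta>(1)] Y0(2) by simp
  moreover from this have "hyperbolic_C1_germ (Y \<alpha>)" for \<alpha>
    using Y_C1 \<delta>(1) Y0(1) \<open>\<mu> \<noteq> 0\<close> unfolding hyperbolic_C1_germ_def C1_germ_def by auto
  ultimately show ?thesis
    using not_conj by (intro exI[of _ "{0..1}"] exI[of _ Y]) auto
qed

end
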